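(* Let $n\ge6$ and let $\mathcal{N}=\bigoplus_{i=1}^n\mathcal{L}_i$, where $\mathcal{L}_i=V_{\lambda_i}$ and $$(\lambda_1,\lambda_2,\lambda_3,\lambda_4,\lambda_5,\lambda_6,\lambda_7,\dots,\lambda_n)=(0,6,6,4,6,2,2r_7,\dots,2r_n),$$ with $r_j\ge4$ pairwise distinct integers. Assume that the only nonzero products on $\mathcal{N}$ are $$[\mathcal{L}_1,\mathcal{L}_2]=\mathcal{L}_3,\quad[\mathcal{L}_2,\mathcal{L}_2]=\mathcal{L}_5,\quad[\mathcal{L}_2,\mathcal{L}_4]=\mathcal{L}_6,\quad[\mathcal{L}_2,\mathcal{L}_5]=\mathcal{L}_6,\quad[\mathcal{L}_4,\mathcal{L}_4]=\mathcal{L}_6\oplus\mathcal{L}_3,$$ together with $[\mathcal{L}_k,\mathcal{L}_k]=\mathcal{L}_6$ for $7\le k\le n$. Then the Lie algebra $\mathcal{L}=\mathfrak{sl}_2\ltimes\mathcal{N}$ is complete.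
   Context: All Lie algebras are finite-dimensional over $\mathbb{C}$. $V_\lambda$ denotes the irreducible $\mathfrak{sl}_2$-module of highest weight $\lambda$ (dimension $\lambda+1$); $\mathfrak{sl}_2$ acts on each $\mathcal{L}_i$ by its module structure. The notation $[\mathcal{L}_i,\mathcal{L}_j]=\mathcal{M}$ means that the restriction of the bracket to $\mathcal{L}_i\times\mathcal{L}_j$ is an $\mathfrak{sl}_2$-equivariant bilinear map (alternating if $i=j$) whose image spans $\mathcal{M}$. A Lie algebra is complete if its center is zero and all its derivations are inner. *)

theory Defs
  imports "HOL-Analysis.Analysis"
begin

text \<open>
  Complex vector spaces are given as in the theory of \<^locale>\<open>vector_space\<close>, by a scalar
  multiplication on an abelian group. All structures below live on a carrier set, which is a
  finite-dimensional subspace of the ambient type; operations are constrained on the carrier only.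
\<close>

locale fd_complex_space = vector_space smul
  for smul :: "complex \<Rightarrow> 'a::ab_group_add \<Rightarrow> 'a" +
  fixes V :: "'a set"
  assumes subspace_carrier: "subspace V"
    and finite_dimensional: "\<exists>B. finite B \<and> span B = V"

definition linear_map_on ::
  "(complex \<Rightarrow> 'a::ab_group_add \<Rightarrow> 'a) \<Rightarrow> 'a set \<Rightarrow>
   (complex \<Rightarrow> 'b::ab_group_add \<Rightarrow> 'b) \<Rightarrow> 'b set \<Rightarrow> ('a \<Rightarrow> 'b) \<Rightarrow> bool" where
  "linear_map_on sa A sb B f \<longleftrightarrow>
     (\<forall>x\<in>A. f x \<in> B) \<and>
     (\<forall>x\<in>A. \<forall>y\<in>A. f (x + y) = f x + f y) \<and>
     (\<forall>c. \<forall>x\<in>A. f (sa c x) = sb c (f x))"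

definition bilinear_map_on ::
  "(complex \<Rightarrow> 'a::ab_group_add \<Rightarrow> 'a) \<Rightarrow> 'a set \<Rightarrow>
   (complex \<Rightarrow> 'b::ab_group_add \<Rightarrow> 'b) \<Rightarrow> 'b set \<Rightarrow>
   (complex \<Rightarrow> 'c::ab_group_add \<Rightarrow> 'c) \<Rightarrow> 'c set \<Rightarrow> ('a \<Rightarrow> 'b \<Rightarrow> 'c) \<Rightarrow> bool" where
  "bilinear_map_on sa A sb B sc C f \<longleftrightarrow>
     (\<forall>x\<in>A. linear_map_on sb B sc C (f x)) \<and>
     (\<forall>y\<in>B. linear_map_on sa A sc C (\<lambda>x. f x y))"

definition alternating_on :: "'a set \<Rightarrow> ('a \<Rightarrow> 'a \<Rightarrow> 'b::zero) \<Rightarrow> bool" where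
  "alternating_on A f \<longleftrightarrow> (\<forall>x\<in>A. f x x = 0)"

locale lie_algebra = fd_complex_space smul g
  for smul :: "complex \<Rightarrow> 'a::ab_group_add \<Rightarrow> 'a" and g :: "'a set" +
  fixes bracket :: "'a \<Rightarrow> 'a \<Rightarrow> 'a"
  assumes bracket_bilinear: "bilinear_map_on smul g smul g smul g bracket"
    and bracket_alternating: "alternating_on g bracket"
    and jacobi: "\<And>x y z. \<lbrakk>x \<in> g; y \<in> g; z \<in> g\<rbrakk> \<Longrightarrow>
      bracket x (bracket y z) + bracket y (bracket z x) + bracket z (bracket x y) = 0"
begin

definition center :: "'a set" where
  "center = {z \<in> g. \<forall>x\<in>g. bracket z x = 0}"

definition derivation :: "('a \<Rightarrow> 'a) \<Rightarrow> bool" where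
  "derivation D \<longleftrightarrow> linear_map_on smul g smul g D \<and>
     (\<forall>x\<in>g. \<forall>y\<in>g. D (bracket x y) = bracket (D x) y + bracket x (D y))"

definition inner_derivation :: "('a \<Rightarrow> 'a) \<Rightarrow> bool" where
  "inner_derivation D \<longleftrightarrow> (\<exists>a\<in>g. \<forall>x\<in>g. D x = bracket a x)"

end

locale complete_lie_algebra = lie_algebra +
  assumes center_trivial: "center = {0}"
    and derivations_inner: "\<And>D. derivation D \<Longrightarrow> inner_derivation D"

locale lie_module =
  lie_algebra scale_g g bracket + M: fd_complex_space smul M
  for scale_g :: "complex \<Rightarrow> 'g::ab_group_add \<Rightarrow> 'g" and g :: "'g set"
    and bracket :: "'g \<Rightarrow> 'g \<Rightarrow> 'g"
    and smul :: "complex \<Rightarrow> 'a::ab_group_add \<Rightarrow> 'a" and M :: "'a set" +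
  fixes act :: "'g \<Rightarrow> 'a \<Rightarrow> 'a"
  assumes act_bilinear: "bilinear_map_on scale_g g smul M smul M act"
    and act_bracket: "\<And>x y v. \<lbrakk>x \<in> g; y \<in> g; v \<in> M\<rbrakk> \<Longrightarrow>
      act (bracket x y) v = act x (act y v) - act y (act x v)"
begin

definition submodule :: "'a set \<Rightarrow> bool" where
  "submodule W \<longleftrightarrow> M.subspace W \<and> W \<subseteq> M \<and> (\<forall>x\<in>g. \<forall>w\<in>W. act x w \<in> W)"

definition irreducible :: bool where
  "irreducible \<longleftrightarrow> M \<noteq> {0} \<and> (\<forall>W. submodule W \<longrightarrow> W = {0} \<or> W = M)"

end


definition mat_scale :: "complex \<Rightarrow> complex^2^2 \<Rightarrow> complex^2^2" where
  "mat_scale c A = (\<chi> i j. c * A $ i $ j)"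

definition commutator :: "complex^2^2 \<Rightarrow> complex^2^2 \<Rightarrow> complex^2^2" where
  "commutator A B = A ** B - B ** A"

definition sl2 :: "(complex^2^2) set" where
  "sl2 = {A. trace A = 0}"

definition sl2_e :: "complex^2^2" where
  "sl2_e = vector [vector [0, 1], vector [0, 0]]"

definition sl2_h :: "complex^2^2" where
  "sl2_h = vector [vector [1, 0], vector [0, -1]]"

abbreviation sl2_module ::
  "(complex \<Rightarrow> 'a::ab_group_add \<Rightarrow> 'a) \<Rightarrow> 'a set \<Rightarrow> (complex^2^2 \<Rightarrow> 'a \<Rightarrow> 'a) \<Rightarrow> bool" where
  "sl2_module \<equiv> lie_module mat_scale sl2 commutator"

text \<open>\<open>irreducible_sl2_module smul V act l\<close> says that \<open>V\<close> is isomorphic to \<open>V\<^sub>l\<close>: a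
  (finite-dimensional) irreducible module containing a highest weight vector of weight \<open>l\<close>.\<close>

definition irreducible_sl2_module ::
  "(complex \<Rightarrow> 'a::ab_group_add \<Rightarrow> 'a) \<Rightarrow> 'a set \<Rightarrow> (complex^2^2 \<Rightarrow> 'a \<Rightarrow> 'a) \<Rightarrow> nat \<Rightarrow> bool" where
  "irreducible_sl2_module smul V act l \<longleftrightarrow>
     sl2_module smul V act \<and>
     lie_module.irreducible sl2 smul V act \<and>
     (\<exists>v\<in>V. v \<noteq> 0 \<and> act sl2_e v = 0 \<and> act sl2_h v = smul (of_nat l) v)"

definition internal_direct_sum ::
  "(complex \<Rightarrow> 'a::ab_group_add \<Rightarrow> 'a) \<Rightarrow> 'i set \<Rightarrow> ('i \<Rightarrow> 'a set) \<Rightarrow> 'a set \<Rightarrow> bool" where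
  "internal_direct_sum smul I L N \<longleftrightarrow>
     (\<forall>i\<in>I. module.subspace smul (L i)) \<and>
     N = {\<Sum>i\<in>I. f i | f. \<forall>i\<in>I. f i \<in> L i} \<and>
     (\<forall>f. (\<forall>i\<in>I. f i \<in> L i) \<and> (\<Sum>i\<in>I. f i) = 0 \<longrightarrow> (\<forall>i\<in>I. f i = 0))"

text \<open>The notation \<open>[A, B] = C\<close> for submodules \<open>A\<close>, \<open>B\<close>, \<open>C\<close> of an \<open>sl2\<close>-module.\<close>

definition sl2_product ::
  "(complex \<Rightarrow> 'a::ab_group_add \<Rightarrow> 'a) \<Rightarrow> (complex^2^2 \<Rightarrow> 'a \<Rightarrow> 'a) \<Rightarrow> ('a \<Rightarrow> 'a \<Rightarrow> 'a) \<Rightarrow>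
   'a set \<Rightarrow> 'a set \<Rightarrow> 'a set \<Rightarrow> bool" where
  "sl2_product smul act br A B C \<longleftrightarrow>
     bilinear_map_on smul A smul B smul C br \<and>
     (\<forall>x\<in>sl2. \<forall>u\<in>A. \<forall>v\<in>B. act x (br u v) = br (act x u) v + br u (act x v)) \<and>
     (A = B \<longrightarrow> alternating_on A br) \<and>
     module.span smul {br u v | u v. u \<in> A \<and> v \<in> B} = C"

definition prod_scale ::
  "(complex \<Rightarrow> 'a \<Rightarrow> 'a) \<Rightarrow> (complex \<Rightarrow> 'b \<Rightarrow> 'b) \<Rightarrow> complex \<Rightarrow> 'a \<times> 'b \<Rightarrow> 'a \<times> 'b" where
  "prod_scale s1 s2 c p = (s1 c (fst p), s2 c (snd p))"

text \<open>The bracket of the semidirect product of \<open>g\<close> and \<open>N\<close>, on the carrier \<open>g \<times> N\<close>.\<close>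

definition semidirect_bracket ::
  "('g \<Rightarrow> 'g \<Rightarrow> 'g) \<Rightarrow> ('g \<Rightarrow> 'a::ab_group_add \<Rightarrow> 'a) \<Rightarrow> ('a \<Rightarrow> 'a \<Rightarrow> 'a) \<Rightarrow>
   'g \<times> 'a \<Rightarrow> 'g \<times> 'a \<Rightarrow> 'g \<times> 'a" where
  "semidirect_bracket brg act br p q =
     (brg (fst p) (fst q),
      act (fst p) (snd q) - act (fst q) (snd p) + br (snd p) (snd q))"

definition highest_weight :: "(nat \<Rightarrow> nat) \<Rightarrow> nat \<Rightarrow> nat" where
  "highest_weight r i = (if i \<le> 6 then [0, 6, 6, 4, 6, 2] ! (i - 1) else 2 * r i)"


text \<open>\<open>sl2\<close> is a Lie algebra, so that \<^const>\<open>sl2_module\<close> only constrains the space and the action.\<close>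

lemma vector_space_mat_scale: "vector_space mat_scale"
  by unfold_locales (auto simp: mat_scale_def vec_eq_iff algebra_simps)

lemma lie_algebra_sl2: "lie_algebra mat_scale sl2 commutator"
proof -
  interpret vector_space mat_scale
    by (rule vector_space_mat_scale)
  have sub: "subspace sl2"
    by (simp add: subspace_def sl2_def trace_def mat_scale_def sum_2 add_eq_0_iff)
  let ?f = "vector [vector [0, 0], vector [1, 0]] :: complex^2^2"
  have "span {sl2_e, sl2_h, ?f} = sl2"
  proof
    show "span {sl2_e, sl2_h, ?f} \<subseteq> sl2"
      by (rule span_minimal[OF _ sub])
        (auto simp: sl2_def sl2_e_def sl2_h_def trace_def sum_2)
  next
    show "sl2 \<subseteq> span {sl2_e, sl2_h, ?f}"
    proof
      fix A assume "A \<in> sl2"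
      then have "A $ 2 $ 2 = - A $ 1 $ 1"
        by (auto simp: sl2_def trace_def sum_2 add_eq_0_iff)
      then have "A = mat_scale (A $ 1 $ 2) sl2_e + mat_scale (A $ 1 $ 1) sl2_h
                   + mat_scale (A $ 2 $ 1) ?f"
        by (simp add: vec_eq_iff forall_2 mat_scale_def sl2_e_def sl2_h_def)
      also have "\<dots> \<in> span {sl2_e, sl2_h, ?f}"
        by (intro span_add span_scale span_base) auto
      finally show "A \<in> span {sl2_e, sl2_h, ?f}" .
    qed
  qed
  then have fin: "\<exists>B. finite B \<and> span B = sl2"
    by (intro exI[of _ "{sl2_e, sl2_h, ?f}"]) simp
  show ?thesis
  proof unfold_locales
    show "subspace sl2" by (rule sub)
    show "\<exists>B. finite B \<and> span B = sl2" by (rule fin)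
    show "bilinear_map_on mat_scale sl2 mat_scale sl2 mat_scale sl2 commutator"
      by (auto simp: bilinear_map_on_def linear_map_on_def commutator_def sl2_def trace_sub
          trace_mul_sym mat_scale_def matrix_matrix_mult_def vec_eq_iff sum_2 algebra_simps
          trace_def)
    show "alternating_on sl2 commutator"
      by (simp add: alternating_on_def commutator_def)
    show "commutator x (commutator y z) + commutator y (commutator z x)
        + commutator z (commutator x y) = 0" for x y z
      by (simp add: commutator_def matrix_matrix_mult_def vec_eq_iff sum_2 algebra_simps)
  qed
qed

end

theory Submission
  imports Defs
begin

text \<open>
  The Jacobi identity on \<open>N\<close> is only in question on \<open>L\<^sub>2\<close>, where it holds because the exterior
  cube of \<open>V\<^sub>6\<close> does not contain \<open>V\<^sub>2\<close>. A central element lies in \<open>L\<^sub>1\<close> and annihilates \<open>L\<^sub>2\<close>, so it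
  vanishes. By Whitehead's first lemma a derivation may be corrected by an inner one until it
  vanishes on \<open>sl2\<close>, and is then \<open>sl2\<close>-equivariant. By Schur's lemma and the products that generate
  \<open>L\<^sub>6\<close>, it maps \<open>N\<close> into \<open>N\<close>, acts on \<open>L\<^sub>i\<close> by a scalar \<open>a\<^sub>i\<close> for \<open>i \<noteq> 2\<close>, and maps \<open>x \<in> L\<^sub>2\<close> to
  \<open>\<alpha> x\<close> plus components in \<open>L\<^sub>3\<close> and \<open>L\<^sub>5\<close>. The component in \<open>L\<^sub>5\<close> is zero, because the multiplicity
  of \<open>V\<^sub>2\<close> in the symmetric square of \<open>V\<^sub>6\<close> is zero. The products force
  \<open>a\<^sub>6 = \<alpha> + a\<^sub>4 = 3 \<alpha> = 2 a\<^sub>4 = 2 a\<^sub>k\<close> for \<open>k \<ge> 7\<close> and \<open>a\<^sub>1 + \<alpha> = 2 a\<^sub>4\<close>, so all scalars vanish, and the remaining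
  map from \<open>L\<^sub>2\<close> to \<open>L\<^sub>3\<close> is a multiple of the bracket with the element spanning \<open>L\<^sub>1\<close>.
\<close>

section \<open>Irreducible modules of sl2\<close>

text \<open>The obstacle is that \<open>L 2\<close>, \<open>L 3\<close> and \<open>L 5\<close> are
  three copies of \<open>V\<^sub>6\<close>, so Schur's lemma alone leaves a 3 by 3 matrix of scalars
  on them. Since \<open>L 3\<close> and \<open>L 5\<close> are spanned by [L_1, L_2] and [L_2, L_2],
  a derivation is determined there by its values on \<open>L 1\<close> and \<open>L 2\<close>, and
  only the entries leaving \<open>L 2\<close> stay open. The entry into \<open>L 5\<close> is
  excluded by parity: the exterior square of \<open>V\<^sub>6\<close> is
  \<open>V\<^sub>1\<^sub>0\<close> + \<open>V\<^sub>6\<close> + \<open>V\<^sub>2\<close> and the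
  symmetric square is \<open>V\<^sub>1\<^sub>2\<close> + \<open>V\<^sub>8\<close> +
  \<open>V\<^sub>4\<close> + \<open>V\<^sub>0\<close>, so the product [L_2, L_5] is skew once
  \<open>L 5\<close> is identified with \<open>L 2\<close>, while the Leibniz rule asks for
  symmetry. The entry into \<open>L 3\<close> survives and is inner. The exterior cube is
  \<open>V\<^sub>1\<^sub>2\<close> + \<open>V\<^sub>8\<close> + \<open>V\<^sub>6\<close> +
  \<open>V\<^sub>4\<close> + \<open>V\<^sub>0\<close>. Instead of these decompositions the proof
  uses a weight count: the multiplicity of \<open>V\<^sub>2\<close> is the dimension of weight space
  2 minus that of weight space 4. The two agree, being 3 in the symmetric square and 4 in the
  exterior cube.\<close>

lemma linear_map_onD:
  assumes "linear_map_on sa A sb B T"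
  shows "x \<in> A \<Longrightarrow> T x \<in> B"
    and "x \<in> A \<Longrightarrow> y \<in> A \<Longrightarrow> T (x + y) = T x + T y"
    and "x \<in> A \<Longrightarrow> T (sa c x) = sb c (T x)"
  using assms unfolding linear_map_on_def by auto

lemma linear_map_on_zero:
  assumes "linear_map_on sa A sb B T" and "0 \<in> A"
  shows "T 0 = 0"
  using linear_map_onD(2)[OF assms(1), of 0 0] assms(2) by simp

lemma linear_map_on_sum:
  assumes "linear_map_on sa A sb B T" and "module sa" and "module.subspace sa A"
    and "\<And>i. i \<in> I \<Longrightarrow> g i \<in> A"
  shows "T (\<Sum>i\<in>I. g i) = (\<Sum>i\<in>I. T (g i))"
proof -
  interpret module sa by fact
  note zero = linear_map_on_zero[OF assms(1) subspace_0[OF assms(3)]]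
  show ?thesis
  proof (cases "finite I")
    case True
    then show ?thesis using assms(4)
      by (induction I)
        (simp_all add: zero linear_map_onD(2)[OF assms(1)] subspace_sum[OF assms(3)])
  qed (simp add: zero)
qed

lemma linear_map_on_diff:
  assumes "linear_map_on sa A sb B T" and "module sa" and "module.subspace sa A"
    and "x \<in> A" "y \<in> A"
  shows "T (x - y) = T x - T y"
proof -
  interpret module sa by fact
  have "T (x - y + y) = T (x - y) + T y"
    by (intro linear_map_onD(2)[OF assms(1)] subspace_diff assms)
  then show ?thesis by simp
qed

section \<open>Linear maps and eigenvectors on spans\<close>

locale complex_space = vector_space scale
  for scale :: "complex \<Rightarrow> 'a::ab_group_add \<Rightarrow> 'a"
begin

lemma linear_map_on_span_closed:
  assumes T: "linear_map_on scale V scale V T" and V: "subspace V" and S: "S \<subseteq> V"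
    and closed: "\<And>b. b \<in> S \<Longrightarrow> T b \<in> span S" and x: "x \<in> span S"
  shows "T x \<in> span S"
proof -
  have "span S \<subseteq> V" using S V by (rule span_minimal)
  \<comment> \<open>Linearity of \<open>T\<close> is known only on \<open>V\<close>, so the
    induction has to carry membership in \<open>V\<close> along.\<close>
  have "x \<in> V \<and> T x \<in> span S"
    using x
  proof (induction rule: span_induct_alt)
    case base
    show ?case using linear_map_on_zero[OF T] subspace_0[OF V] by (simp add: span_zero)
  next
    case (step c b y)
    have bV: "b \<in> V" using step S by auto
    have "T (scale c b + y) = scale c (T b) + T y"
      using linear_map_onD(2,3)[OF T] bV step subspace_scale[OF V bV] by simp
    then show ?case
      using bV step closed V by (auto intro: span_add span_scale subspace_add subspace_scale)
  qed
  then show ?thesis ..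
qed

lemma linear_zero_on_span:
  assumes T: "linear_map_on scale V sb B T" and sb: "module sb" and V: "subspace V"
    and S: "S \<subseteq> V" and zero: "\<And>b. b \<in> S \<Longrightarrow> T b = 0" and x: "x \<in> span S"
  shows "T x = 0"
proof -
  interpret B: module sb by fact
  have "x \<in> V \<and> T x = 0"
    using x
  proof (induction rule: span_induct_alt)
    case base
    show ?case using linear_map_on_zero[OF T] subspace_0[OF V] by simp
  next
    case (step c b y)
    then have "b \<in> V" "T b = 0" using zero S by auto
    then show ?case
      using step subspace_add[OF V] subspace_scale[OF V] by (simp add: linear_map_onD(2,3)[OF T])
  qed
  then show ?thesis ..
qed

text \<open>Generators are removed one at a time: if \<open>u\<close> is \<open>c b\<close> plus a
  vector of the remaining span, then \<open>T - \<mu> b\<close> sends that vector to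
  \<open>(m - \<mu> b) u\<close>, so \<open>u\<close> lies in the smaller span unless
  \<open>m = \<mu> b\<close>. The argument works for dependent generators and repeated
  eigenvalues.\<close>

lemma eigenvector_in_span:
  assumes T: "linear_map_on scale V scale V T" and V: "subspace V" and S: "S \<subseteq> V"
    and eig: "\<And>b. b \<in> S \<Longrightarrow> T b = scale (\<mu> b) b"
    and u: "u \<in> span S" "u \<noteq> 0" "T u = scale m u"
  shows "\<exists>b\<in>S. m = \<mu> b"
proof -
  from u(1) obtain B where B: "finite B" "B \<subseteq> S" "u \<in> span B"
    unfolding span_explicit by (auto intro: span_sum span_scale span_base)
  from B(1,2,3) have "\<exists>b\<in>B. m = \<mu> b"
  proof (induction B rule: finite_induct)
    case empty
    then show ?case using u by simp
  next
    case (insert b B)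
    show ?case
    proof (cases "m = \<mu> b")
      case False
      obtain c where c: "u - scale c b \<in> span B"
        using insert.prems(2) span_breakdown_eq by blast
      have BV: "B \<subseteq> V" and bV: "b \<in> V" using insert.prems S by auto
      have spanV: "span B \<subseteq> V" using BV V by (rule span_minimal)
      let ?w = "u - scale c b"
      have "T ?w \<in> span B"
      proof (rule linear_map_on_span_closed[OF T V BV _ c])
        fix b' assume "b' \<in> B"
        moreover from this have "T b' = scale (\<mu> b') b'" using eig insert.prems by auto
        ultimately show "T b' \<in> span B" by (simp add: span_scale span_base)
      qed
      then have "T ?w - scale (\<mu> b) ?w \<in> span B"
        using c by (auto intro: span_diff span_scale)
      moreover have "T ?w = scale m u - scale c (scale (\<mu> b) b)"
      proof -
        have "T u = T ?w + T (scale c b)"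
          using linear_map_onD(2)[OF T, of ?w "scale c b"] c spanV subspace_scale[OF V bV] by auto
        then show ?thesis
          using linear_map_onD(3)[OF T bV] u(3) eig insert.prems by (simp add: eq_diff_eq)
      qed
      moreover have "scale m u - scale c (scale (\<mu> b) b) - scale (\<mu> b) ?w = scale (m - \<mu> b) u"
        by (simp add: algebra_simps)
      ultimately have "scale (m - \<mu> b) u \<in> span B" by simp
      then have "scale (inverse (m - \<mu> b)) (scale (m - \<mu> b) u) \<in> span B"
        by (rule span_scale)
      then have "u \<in> span B" using False by simp
      then show ?thesis using insert by auto
    qed simp
  qed
  then show ?thesis using B by auto
qed

end

section \<open>Highest weight theory of a single irreducible module\<close>

text \<open>Three abstract endomorphisms replace the action, so that the components
  \<open>L i\<close> and the adjoint module of sl2 are instances of the same locale.\<close>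

locale sl2_irrep = complex_space smul
  for smul :: "complex \<Rightarrow> 'a::ab_group_add \<Rightarrow> 'a" +
  fixes V :: "'a set" and e h f :: "'a \<Rightarrow> 'a" and l :: nat and v0 :: 'a
  assumes V: "subspace V"
    and e_linear: "linear_map_on smul V smul V e"
    and h_linear: "linear_map_on smul V smul V h"
    and f_linear: "linear_map_on smul V smul V f"
    and h_e: "x \<in> V \<Longrightarrow> h (e x) = e (h x) + smul 2 (e x)"
    and h_f: "x \<in> V \<Longrightarrow> h (f x) = f (h x) - smul 2 (f x)"
    and e_f: "x \<in> V \<Longrightarrow> e (f x) = f (e x) + h x"
    and v0: "v0 \<in> V" "v0 \<noteq> 0" "e v0 = 0" "h v0 = smul (of_nat l) v0"
    and irreducible: "\<lbrakk>subspace W; W \<subseteq> V; \<And>x. x \<in> W \<Longrightarrow> e x \<in> W \<and> h x \<in> W \<and> f x \<in> W\<rbrakk>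
      \<Longrightarrow> W = {0} \<or> W = V"
begin

lemmas e_simps = linear_map_onD[OF e_linear] linear_map_on_zero[OF e_linear subspace_0[OF V]]
  linear_map_on_diff[OF e_linear module_axioms V]
lemmas h_simps = linear_map_onD[OF h_linear] linear_map_on_zero[OF h_linear subspace_0[OF V]]
  linear_map_on_diff[OF h_linear module_axioms V]
lemmas f_simps = linear_map_onD[OF f_linear] linear_map_on_zero[OF f_linear subspace_0[OF V]]
  linear_map_on_diff[OF f_linear module_axioms V]
lemmas V_closed = subspace_0[OF V] subspace_add[OF V] subspace_diff[OF V] subspace_scale[OF V]

text \<open>The form in which irreducibility is applied: to the span of an f-string, to the
  eigenspace of the Casimir operator, and later to an annihilator inside \<open>L 5\<close>.\<close>

lemma full_if_contains:
  assumes "subspace W" "W \<subseteq> V" "u \<in> W" "u \<noteq> 0"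
    and "\<And>x. x \<in> W \<Longrightarrow> e x \<in> W \<and> h x \<in> W \<and> f x \<in> W"
  shows "W = V"
  using irreducible[OF assms(1,2,5)] assms(3,4) by auto

lemma f_power_in: "u \<in> V \<Longrightarrow> (f ^^ k) u \<in> V"
  by (induction k) (simp_all add: f_simps)

lemma h_f_power:
  assumes "u \<in> V" "h u = smul m u"
  shows "h ((f ^^ k) u) = smul (m - 2 * of_nat k) ((f ^^ k) u)"
proof (induction k)
  case 0
  show ?case using assms by simp
next
  case (Suc k)
  have "h ((f ^^ Suc k) u) = f (h ((f ^^ k) u)) - smul 2 ((f ^^ Suc k) u)"
    using f_power_in[OF assms(1)] by (simp add: h_f)
  also have "\<dots> = smul (m - 2 * of_nat (Suc k)) ((f ^^ Suc k) u)"
    using f_power_in[OF assms(1)] Suc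
    by (simp add: f_simps diff_diff_eq flip: scale_left_diff_distrib)
  finally show ?case .
qed

text \<open>The factor \<open>m - of_nat k\<close> is the source of finiteness: for
  \<open>m = of_nat k\<close> the vector \<open>(f ^^ Suc k) u\<close> is again killed by
  \<open>e\<close>.\<close>

lemma e_f_power:
  assumes "u \<in> V" "e u = 0" "h u = smul m u"
  shows "e ((f ^^ Suc k) u) = smul (of_nat (Suc k) * (m - of_nat k)) ((f ^^ k) u)"
proof (induction k)
  case 0
  show ?case using assms by (simp add: e_f f_simps)
next
  case (Suc k)
  have "e ((f ^^ Suc (Suc k)) u) = f (e ((f ^^ Suc k) u)) + h ((f ^^ Suc k) u)"
    using f_power_in[OF assms(1), of "Suc k"] by (simp add: e_f)
  also have "\<dots> = smul (of_nat (Suc k) * (m - of_nat k)) ((f ^^ Suc k) u)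
      + smul (m - 2 * of_nat (Suc k)) ((f ^^ Suc k) u)"
    unfolding Suc h_f_power[OF assms(1,3)] using f_power_in[OF assms(1)] by (simp add: f_simps)
  also have "\<dots> = smul (of_nat (Suc (Suc k)) * (m - of_nat (Suc k))) ((f ^^ Suc k) u)"
    unfolding scale_left_distrib[symmetric]
    by (rule arg_cong[where f = "\<lambda>c. smul c _"]) (simp add: algebra_simps)
  finally show ?case .
qed

lemma span_f_powers:
  assumes u: "u \<in> V" "u \<noteq> 0" "e u = 0" "h u = smul m u"
  shows "span (range (\<lambda>k. (f ^^ k) u)) = V"
proof -
  let ?S = "range (\<lambda>k. (f ^^ k) u)"
  have S: "?S \<subseteq> V" using f_power_in[OF u(1)] by auto
  have in_S: "(f ^^ k) u \<in> span ?S" for k by (intro span_base) auto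
  show ?thesis
  proof (rule full_if_contains)
    show "span ?S \<subseteq> V" using S V by (rule span_minimal)
    show "u \<in> span ?S" using in_S[of 0] by simp
    fix x assume x: "x \<in> span ?S"
    have "e x \<in> span ?S"
    proof (rule linear_map_on_span_closed[OF e_linear V S _ x])
      fix b assume "b \<in> ?S"
      then obtain k where b: "b = (f ^^ k) u" by auto
      show "e b \<in> span ?S"
      proof (cases k)
        case 0
        then show ?thesis using b u by (simp add: span_zero)
      next
        case (Suc j)
        show ?thesis unfolding b Suc e_f_power[OF u(1,3,4)] by (intro span_scale in_S)
      qed
    qed
    moreover have "h x \<in> span ?S"
      by (rule linear_map_on_span_closed[OF h_linear V S _ x])
        (auto simp: h_f_power[OF u(1,4)] intro!: span_scale in_S)
    moreover have "f x \<in> span ?S"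
    proof (rule linear_map_on_span_closed[OF f_linear V S _ x])
      fix b assume "b \<in> ?S"
      then obtain k where "f b = (f ^^ Suc k) u" by auto
      then show "f b \<in> span ?S" using in_S by metis
    qed
    ultimately show "e x \<in> span ?S \<and> h x \<in> span ?S \<and> f x \<in> span ?S" by blast
  qed (use u in auto)
qed

text \<open>The exponent set \<open>K\<close> is kept general for two uses: all exponents, to
  compare two highest weights, and the exponents from 1 on, to show that nothing below the top
  vector has the top weight.\<close>

lemma weight_in_span_f_powers:
  assumes u: "u \<in> V" "h u = smul m u" and w: "w \<noteq> 0" "h w = smul m' w"
    and w_in: "w \<in> span ((\<lambda>k. (f ^^ k) u) ` K)"
  shows "\<exists>k\<in>K. m' = m - 2 * of_nat k"
proof -
  \<comment> \<open>Zero is an eigenvector for every scalar; without it the eigenvalue can be read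
    off from the vector itself, which defines \<open>\<mu>\<close>.\<close>
  let ?S = "((\<lambda>k. (f ^^ k) u) ` K) - {0}"
  define \<mu> where "\<mu> b = (THE c. h b = smul c b)" for b
  have \<mu>: "\<mu> b = c" if "b \<noteq> 0" "h b = smul c b" for b c
    unfolding \<mu>_def using that by (intro the_equality) (auto simp: scale_right_imp_eq)
  have "w \<in> span ?S" using w_in by simp
  moreover have "h b = smul (\<mu> b) b" if "b \<in> ?S" for b
  proof -
    from that obtain k where "b = (f ^^ k) u" "b \<noteq> 0" by auto
    then show ?thesis using h_f_power[OF u, of k] \<mu> by metis
  qed
  ultimately obtain b where b: "b \<in> ?S" "m' = \<mu> b"
    using eigenvector_in_span[OF h_linear V, of ?S \<mu> w m'] f_power_in[OF u(1)] w by blast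
  then obtain k where k: "k \<in> K" "b = (f ^^ k) u" "b \<noteq> 0" by auto
  then have "\<mu> b = m - 2 * of_nat k" using \<mu> h_f_power[OF u] by blast
  with b k show ?thesis by auto
qed

text \<open>Each vector lies in the f-string span of the other, so each weight arises from the other
  by subtracting a nonnegative even integer; both integers are then zero.\<close>

lemma highest_weight_unique:
  assumes u: "u \<in> V" "u \<noteq> 0" "e u = 0" "h u = smul m u"
    and w: "w \<in> V" "w \<noteq> 0" "e w = 0" "h w = smul m' w"
  shows "m = m'"
proof -
  obtain k where k: "m' = m - 2 * of_nat k"
    using weight_in_span_f_powers[OF u(1,4) w(2,4), of UNIV] span_f_powers[OF u] w by auto
  obtain j where j: "m = m' - 2 * of_nat j"
    using weight_in_span_f_powers[OF w(1,4) u(2,4), of UNIV] span_f_powers[OF w] u by auto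
  have "(of_nat (2 * k + 2 * j) :: complex) = 0" using k j by (simp add: algebra_simps)
  then have "k = 0" unfolding of_nat_eq_0_iff by simp
  then show ?thesis using k by simp
qed

lemma highest_weight_zero:
  assumes "u \<in> V" "e u = 0" "h u = smul m u" "m \<noteq> of_nat l"
  shows "u = 0"
  using highest_weight_unique[OF assms(1) _ assms(2,3) v0] assms(4) by blast

text \<open>Modulo the lower part of the f-string, \<open>u\<close> is a multiple of
  \<open>w\<close>. The difference has weight \<open>m\<close>, whereas the lower part only has the
  weights \<open>m - 2 k\<close> with \<open>k \<ge> 1\<close>.\<close>

lemma highest_weight_multiple:
  assumes w: "w \<in> V" "w \<noteq> 0" "e w = 0" "h w = smul m w"
    and u: "u \<in> V" "e u = 0" "h u = smul m u"
  shows "\<exists>c. u = smul c w"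
proof -
  have "range (\<lambda>k. (f ^^ k) w) = insert w ((\<lambda>k. (f ^^ k) w) ` {1..})"
  proof -
    have UNIV: "(UNIV :: nat set) = insert 0 {1..}" by auto
    show ?thesis by (subst UNIV) simp
  qed
  then have "u \<in> span (insert w ((\<lambda>k. (f ^^ k) w) ` {1..}))"
    using span_f_powers[OF w] u by simp
  then obtain c where c: "u - smul c w \<in> span ((\<lambda>k. (f ^^ k) w) ` {1..})"
    using span_breakdown_eq by blast
  have "h (u - smul c w) = smul m (u - smul c w)"
    using u w V_closed by (simp add: h_simps algebra_simps)
  then have "u - smul c w = 0"
    using weight_in_span_f_powers[OF w(1,4) _ _ c, of m] by auto
  then show ?thesis by auto
qed

text \<open>At \<open>k = Suc l\<close> the coefficient in \<open>e_f_power\<close> is zero, so the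
  vector is killed by \<open>e\<close>; its weight \<open>l - 2 k\<close> differs from the only
  possible highest weight \<open>l\<close>.\<close>

lemma f_power_vanishes: "k > l \<Longrightarrow> (f ^^ k) v0 = 0"
proof (induction k rule: less_induct)
  case (less k)
  show ?case
  proof (cases "k = Suc l")
    case True
    show ?thesis
    proof (rule highest_weight_zero)
      show "e ((f ^^ k) v0) = 0"
        unfolding True e_f_power[OF v0(1,3,4)] by simp
      show "h ((f ^^ k) v0) = smul (of_nat l - 2 * of_nat k) ((f ^^ k) v0)"
        by (rule h_f_power[OF v0(1,4)])
      have "(of_nat (2 * k) :: complex) \<noteq> 0"
        unfolding of_nat_eq_0_iff using less by simp
      then show "(of_nat l - 2 * of_nat k :: complex) \<noteq> of_nat l" by simp
    qed (rule f_power_in[OF v0(1)])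
  next
    case False
    then obtain j where "k = Suc j" "j > l" using less by (cases k) auto
    then show ?thesis using less f_simps by simp
  qed
qed

text \<open>The Casimir operator commutes with \<open>e\<close>, \<open>h\<close> and
  \<open>f\<close>, so its eigenspace through \<open>v0\<close> is a submodule. On \<open>v0\<close>
  it acts by \<open>l + l^2 / 2\<close>, because \<open>e (f v0) = h v0\<close>.\<close>

lemma casimir_scalar:
  assumes "x \<in> V"
  shows "e (f x) + f (e x) + smul (1/2) (h (h x)) = smul (of_nat l * (of_nat l + 2) / 2) x"
proof -
  define C where "C x = e (f x) + f (e x) + smul (1/2) (h (h x))" for x
  define c where "c = (of_nat l * (of_nat l + 2) / 2 :: complex)"
  let ?W = "{x \<in> V. C x = smul c x}"
  have linear: "linear_map_on smul V smul V C"
    unfolding linear_map_on_def C_def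
    by (simp add: e_simps f_simps h_simps V_closed algebra_simps)
  have two: "y + y = smul 2 y" for y using scale_left_distrib[of 1 1 y] by simp
  have comm: "C (e x) = e (C x)" "C (h x) = h (C x)" "C (f x) = f (C x)" if "x \<in> V" for x
    unfolding C_def using that
    by (simp_all add: e_simps f_simps h_simps V_closed e_f h_e h_f algebra_simps two)
  have "?W = V"
  proof (rule full_if_contains)
    show "subspace ?W"
      unfolding subspace_def
      by (auto simp: linear_map_onD(2,3)[OF linear] linear_map_on_zero[OF linear] V_closed
          scale_right_distrib mult.commute)
    have "C v0 = smul (of_nat l + of_nat l * of_nat l / 2) v0"
      unfolding C_def using v0 by (simp add: e_f f_simps h_simps scale_left_distrib)
    also have "of_nat l + of_nat l * of_nat l / 2 = c"
      by (simp add: c_def field_simps)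
    finally show "v0 \<in> ?W" using v0 by simp
    show "e x \<in> ?W \<and> h x \<in> ?W \<and> f x \<in> ?W" if "x \<in> ?W" for x
      using that by (auto simp: comm e_simps h_simps f_simps)
  qed (use v0 in auto)
  with assms have "x \<in> ?W" by blast
  then show ?thesis by (simp add: C_def c_def)
qed

end

section \<open>Homomorphisms and cocycles\<close>

context sl2_irrep
begin

lemma double_eq_0: "x + x = 0 \<longleftrightarrow> x = 0" for x :: 'a
proof -
  have "x + x = smul 2 x" using scale_left_distrib[of 1 1 x] by simp
  then show ?thesis by simp
qed

lemma linear_zero_if_zero_on_f_powers:
  assumes T: "linear_map_on smul V sb B T" and sb: "module sb"
    and zero: "\<And>k. T ((f ^^ k) v0) = 0" and x: "x \<in> V"
  shows "T x = 0"
proof (rule linear_zero_on_span[OF T sb V])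
  show "range (\<lambda>k. (f ^^ k) v0) \<subseteq> V" using f_power_in[OF v0(1)] by blast
  show "x \<in> span (range (\<lambda>k. (f ^^ k) v0))" using x span_f_powers[OF v0] by simp
qed (use zero in blast)

text \<open>Commutation with \<open>f\<close> is enough, since the f-string of \<open>v0\<close>
  spans the module.\<close>

lemma hom_zero:
  assumes T: "linear_map_on smul V sb B T" and sb: "module sb"
    and comm: "\<And>x. x \<in> V \<Longrightarrow> T (f x) = f' (T x)" and "f' 0 = 0" "T v0 = 0"
    and x: "x \<in> V"
  shows "T x = 0"
proof (rule linear_zero_if_zero_on_f_powers[OF T sb _ x])
  show "T ((f ^^ k) v0) = 0" for k
    by (induction k) (simp_all add: assms comm f_power_in[OF v0(1)])
qed

text \<open>For \<open>l = 0\<close> the map \<open>f\<close> kills its own string; then h = [e, f]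
  and 2 e = [h, e] vanish as well.\<close>

lemma trivial_if_weight_zero:
  assumes "l = 0" and x: "x \<in> V"
  shows "e x = 0" "h x = 0" "f x = 0"
proof -
  have f: "f x = 0" if "x \<in> V" for x
    by (rule linear_zero_if_zero_on_f_powers[OF f_linear module_axioms _ that])
      (use f_power_vanishes assms in \<open>simp flip: funpow.simps(2) comp_apply[of f]\<close>)
  have h: "h x = 0" if "x \<in> V" for x
    using e_f[OF that] f that by (simp add: e_simps)
  have e: "e x = 0" if "x \<in> V" for x
    using h_e[OF that] h that by (simp add: e_simps)
  show "e x = 0" "h x = 0" "f x = 0" by (intro e h f x)+
qed

text \<open>Whitehead's first lemma for \<open>V\<close>: the hypotheses say that \<open>e \<mapsto> E\<close>, \<open>h \<mapsto> H\<close>, \<open>f \<mapsto> F\<close> is a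
  1-cocycle. For \<open>l > 0\<close> it is the coboundary of the contraction of the cocycle with the Casimir
  tensor, divided by the Casimir scalar.\<close>

lemma cocycle_is_coboundary:
  assumes in_V: "E \<in> V" "H \<in> V" "F \<in> V"
    and cocycle: "e F = H + f E" "h E = e H + smul 2 E" "h F = f H - smul 2 F"
  shows "\<exists>a\<in>V. e a = E \<and> h a = H \<and> f a = F"
proof (cases "l = 0")
  case True
  note trivial = trivial_if_weight_zero[OF True]
  have "E = 0" "H = 0" "F = 0"
    using cocycle in_V by (simp_all add: trivial)
  then show ?thesis using V_closed(1) by (intro bexI[of _ 0]) (simp_all add: trivial)
next
  case False
  define C where "C x = e (f x) + f (e x) + smul (1/2) (h (h x))" for x
  define c where "c = (of_nat l * (of_nat l + 2) / 2 :: complex)"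
  have "of_nat l * of_nat (l + 2) \<noteq> (0::complex)"
    unfolding of_nat_mult[symmetric] of_nat_eq_0_iff using False by simp
  then have "of_nat l * (of_nat l + 2) \<noteq> (0::complex)" unfolding of_nat_add of_nat_numeral .
  then have c: "c \<noteq> 0" by (metis c_def divide_eq_0_iff zero_neq_numeral)
  have C: "C x = smul c x" if "x \<in> V" for x
    using casimir_scalar[OF that] by (simp add: C_def c_def)
  \<comment> \<open>The Casimir operator with each inner factor replaced by the cocycle value. If
    the cocycle is the coboundary of some \<open>b\<close>, this is \<open>C b\<close>, which
    suggests the identities \<open>e a = C E\<close> and so on; the cocycle relations alone prove
    them.\<close>
  define a where "a = e F + f E + smul (1/2) (h H)"
  have a: "a \<in> V" using in_V by (simp add: a_def e_simps f_simps h_simps V_closed)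
  have two: "y + y = smul 2 y" for y using scale_left_distrib[of 1 1 y] by simp
  have "e a = C E" "h a = C H" "f a = C F"
    unfolding C_def a_def using in_V
    by (simp_all add: cocycle e_simps f_simps h_simps V_closed e_f h_e h_f algebra_simps two)
  then show ?thesis
    using a c in_V
    by (intro bexI[of _ "smul (inverse c) a"]) (simp_all add: C e_simps f_simps h_simps V_closed)
qed

end

section \<open>Schur's lemma\<close>

text \<open>The image of the highest weight vector is killed by \<open>e'\<close> and has weight
  \<open>l\<close>, but nonzero vectors of this kind in \<open>W\<close> have weight
  \<open>m\<close>.\<close>

lemma schur_zero:
  assumes V: "sl2_irrep sa V e h f l v" and W: "sl2_irrep sb W e' h' f' m w" and "l \<noteq> m"
    and T: "linear_map_on sa V sb W T"
    and comm: "\<And>x. x \<in> V \<Longrightarrow> T (e x) = e' (T x)" "\<And>x. x \<in> V \<Longrightarrow> T (h x) = h' (T x)"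
      "\<And>x. x \<in> V \<Longrightarrow> T (f x) = f' (T x)"
    and x: "x \<in> V"
  shows "T x = 0"
proof -
  interpret V: sl2_irrep sa V e h f l v by fact
  interpret W: sl2_irrep sb W e' h' f' m w by fact
  have "e' (T v) = 0"
    using comm(1)[OF V.v0(1)] V.v0(3) linear_map_on_zero[OF T V.V_closed(1)] by simp
  moreover have "h' (T v) = sb (of_nat l) (T v)"
    using comm(2)[OF V.v0(1)] V.v0(4) linear_map_onD(3)[OF T V.v0(1)] by simp
  ultimately have "T v = 0"
    using W.highest_weight_zero[OF linear_map_onD(1)[OF T V.v0(1)], where m = "of_nat l"] \<open>l \<noteq> m\<close> by auto
  then show ?thesis
    using V.hom_zero[OF T W.module_axioms comm(3) W.f_simps(4)] x by blast
qed

text \<open>The images of \<open>v\<close> under \<open>T\<close> and \<open>S\<close> are both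
  killed by \<open>e'\<close> and share a weight, hence are proportional, and the corresponding
  difference of maps kills \<open>v\<close>. The reference map \<open>S\<close> is free: the
  identity yields scalars on a component, and the bracket with a vector of \<open>L 1\<close>
  describes the maps from \<open>L 2\<close> to \<open>L 3\<close>.\<close>

lemma schur_multiple:
  assumes V: "sl2_irrep sa V e h f l v" and W: "sl2_irrep sb W e' h' f' m w"
    and T: "linear_map_on sa V sb W T"
    and T_comm: "\<And>x. x \<in> V \<Longrightarrow> T (e x) = e' (T x)" "\<And>x. x \<in> V \<Longrightarrow> T (h x) = h' (T x)"
      "\<And>x. x \<in> V \<Longrightarrow> T (f x) = f' (T x)"
    and S: "linear_map_on sa V sb W S"
    and S_comm: "\<And>x. x \<in> V \<Longrightarrow> S (e x) = e' (S x)" "\<And>x. x \<in> V \<Longrightarrow> S (h x) = h' (S x)"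
      "\<And>x. x \<in> V \<Longrightarrow> S (f x) = f' (S x)"
    and S_nonzero: "\<exists>x\<in>V. S x \<noteq> 0"
  shows "\<exists>c. \<forall>x\<in>V. T x = sb c (S x)"
proof -
  interpret V: sl2_irrep sa V e h f l v by fact
  interpret W: sl2_irrep sb W e' h' f' m w by fact
  have "S v \<noteq> 0"
    using V.hom_zero[OF S W.module_axioms S_comm(3) W.f_simps(4)] S_nonzero by blast
  moreover have "e' (S v) = 0" "h' (S v) = sb (of_nat l) (S v)"
    "e' (T v) = 0" "h' (T v) = sb (of_nat l) (T v)"
    using V.v0 V.V_closed T_comm(1,2)[of v, symmetric] S_comm(1,2)[of v, symmetric]
    by (auto simp: linear_map_onD[OF T] linear_map_on_zero[OF T]
        linear_map_onD[OF S] linear_map_on_zero[OF S])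
  ultimately obtain c where c: "T v = sb c (S v)"
    using W.highest_weight_multiple[of "S v" "of_nat l" "T v"] V.v0
    by (auto simp: linear_map_onD[OF T] linear_map_onD[OF S])
  have lin: "linear_map_on sa V sb W (\<lambda>x. T x - sb c (S x))"
    unfolding linear_map_on_def
    by (simp add: linear_map_onD[OF T] linear_map_onD[OF S] W.V_closed algebra_simps)
  have "T x - sb c (S x) = 0" if "x \<in> V" for x
    by (rule V.hom_zero[OF lin W.module_axioms, of f', OF _ W.f_simps(4) _ that])
      (simp_all add: c T_comm S_comm linear_map_onD[OF T] linear_map_onD[OF S] W.f_simps W.V_closed)
  then show ?thesis by auto
qed

text \<open>The values on the pairs \<open>(f\<^sup>i v, f\<^sup>j v)\<close> vanish by induction on \<open>i + j\<close>: a value killed by \<open>e\<close>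
  vanishes unless it has weight 2, that is, \<open>i + j = 5\<close>, and there the images under \<open>f\<close> of the
  vanishing values with \<open>i + j = 4\<close> give enough linear relations. The trilinear case below is
  the same, with 8 and 7 in place of 5 and 4.\<close>

lemma symmetric_bilinear_V6_to_V2_zero:
  assumes V: "sl2_irrep smul V e h f 6 v" and W: "sl2_irrep smul W e h f 2 w"
    and F: "bilinear_map_on smul V smul V smul W F"
    and equiv: "\<And>T x y. T \<in> {e, h, f} \<Longrightarrow> x \<in> V \<Longrightarrow> y \<in> V \<Longrightarrow> T (F x y) = F (T x) y + F x (T y)"
    and sym: "\<And>x y. x \<in> V \<Longrightarrow> y \<in> V \<Longrightarrow> F x y = F y x"
    and xy: "x \<in> V" "y \<in> V"
  shows "F x y = 0"
proof -
  interpret V: sl2_irrep smul V e h f 6 v by fact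
  interpret W: sl2_irrep smul W e h f 2 w by fact
  have F1: "linear_map_on smul V smul W (F x)" if "x \<in> V" for x
    using F that by (simp add: bilinear_map_on_def)
  have F2: "linear_map_on smul V smul W (\<lambda>x. F x y)" if "y \<in> V" for y
    using F that by (simp add: bilinear_map_on_def)
  note F1s = linear_map_onD[OF F1] linear_map_on_zero[OF F1]
  note F2s = linear_map_onD[OF F2] linear_map_on_zero[OF F2]
  note eqv = equiv[of e, simplified] equiv[of h, simplified] equiv[of f, simplified]
  define X where "X k = (f ^^ k) v" for k
  have X: "X k \<in> V" for k unfolding X_def by (rule V.f_power_in[OF V.v0(1)])
  have hX: "h (X k) = smul (6 - 2 * of_nat k) (X k)" for k
    using V.h_f_power[OF V.v0(1,4), of k] by (simp add: X_def)
  have fX: "f (X k) = X (Suc k)" for k by (simp add: X_def)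
  \<comment> \<open>At \<open>k = 0\<close> the truncated index \<open>k - 1\<close> is harmless
    because the coefficient is zero there.\<close>
  have eX: "\<exists>c. e (X k) = smul c (X (k - 1)) \<and> (k = 0 \<longrightarrow> c = 0)" for k
    using V.e_f_power[OF V.v0(1,3,4), of "k - 1"] V.v0(3)
    by (cases k) (auto simp: X_def)
  define S where "S i j = F (X i) (X j)" for i j
  have SW: "S i j \<in> W" for i j by (simp add: S_def F1s X)
  have hS: "h (S i j) = smul (12 - 2 * of_nat (i + j)) (S i j)" for i j
  proof -
    have "h (S i j) = smul (6 - 2 * of_nat i) (S i j) + smul (6 - 2 * of_nat j) (S i j)"
      by (simp add: S_def eqv X hX F1s F2s)
    then show ?thesis unfolding V.scale_left_distrib[symmetric] by (simp add: algebra_simps)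
  qed
  have fS: "f (S i j) = S (Suc i) j + S i (Suc j)" for i j
    by (simp add: S_def eqv X fX)
  have S_sym: "S i j = S j i" for i j unfolding S_def by (intro sym X)
  have zero: "i + j = s \<Longrightarrow> S i j = 0" for i j s
  proof (induction s arbitrary: i j rule: less_induct)
    case (less s)
    show ?case
    proof (cases "s = 5")
      case True
      have rel: "S (Suc a) b + S a (Suc b) = 0" if "a + b = 4" for a b
        using fS[of a b] less.IH[of 4 a b] that True W.f_simps by simp
      \<comment> \<open>By symmetry the relation for \<open>(2, 2)\<close> reads
        \<open>S 2 3 + S 2 3 = 0\<close>. The relations for \<open>(1, 3)\<close> and
        \<open>(0, 4)\<close> carry the vanishing outwards.\<close>
      have S23: "S 2 3 = 0"
        using rel[of 2 2] S_sym[of 3 2] V.double_eq_0 by (simp add: eval_nat_numeral)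
      have S14: "S 1 4 = 0"
        using rel[of 1 3] S23 by (simp add: eval_nat_numeral)
      have S05: "S 0 5 = 0"
        using rel[of 0 4] S14 by (simp add: eval_nat_numeral)
      have "i \<in> {0,1,2,3,4,5}" "j = 5 - i" using less.prems True by auto
      then show ?thesis using S23 S14 S05 S_sym[of i j] by auto
    next
      case False
      have "e (S i j) = 0"
      proof -
        obtain c d where c: "e (X i) = smul c (X (i - 1))" "i = 0 \<longrightarrow> c = 0"
          and d: "e (X j) = smul d (X (j - 1))" "j = 0 \<longrightarrow> d = 0"
          using eX by meson
        have "e (S i j) = smul c (S (i - 1) j) + smul d (S i (j - 1))"
          by (simp add: S_def eqv X F1s F2s c(1) d(1))
        moreover have "smul c (S (i - 1) j) = 0"
          using less.IH[of "s - 1" "i - 1" j] less.prems c(2) by (cases i) auto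
        moreover have "smul d (S i (j - 1)) = 0"
          using less.IH[of "s - 1" i "j - 1"] less.prems d(2) by (cases j) auto
        ultimately show ?thesis by (simp only: add_0_right)
      qed
      moreover have "12 - 2 * of_nat (i + j) \<noteq> (of_nat 2 :: complex)"
      proof
        assume "12 - 2 * of_nat (i + j) = (of_nat 2 :: complex)"
        then have "of_nat (2 + 2 * (i + j)) = (of_nat 12 :: complex)" by (simp add: algebra_simps)
        then have "2 + 2 * (i + j) = 12" unfolding of_nat_eq_iff .
        then show False using False less.prems by simp
      qed
      ultimately show ?thesis using W.highest_weight_zero[OF SW _ hS] by blast
    qed
  qed
  have "F (X i) y = 0" if "y \<in> V" for i y
    using V.linear_zero_if_zero_on_f_powers[OF F1 V.module_axioms _ that, of "X i"] X zero
    by (simp add: S_def X_def)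
  then show ?thesis
    using V.linear_zero_if_zero_on_f_powers[OF F2[OF xy(2)] V.module_axioms _ xy(1)] xy
    by (simp add: X_def)
qed

lemma alternating_trilinear_V6_to_V2_zero:
  assumes V: "sl2_irrep smul V e h f 6 v" and W: "sl2_irrep smul W e h f 2 w"
    and J1: "\<And>y z. y \<in> V \<Longrightarrow> z \<in> V \<Longrightarrow> linear_map_on smul V smul W (\<lambda>x. J x y z)"
    and J2: "\<And>x z. x \<in> V \<Longrightarrow> z \<in> V \<Longrightarrow> linear_map_on smul V smul W (\<lambda>y. J x y z)"
    and J3: "\<And>x y. x \<in> V \<Longrightarrow> y \<in> V \<Longrightarrow> linear_map_on smul V smul W (\<lambda>z. J x y z)"
    and equiv: "\<And>T x y z. T \<in> {e, h, f} \<Longrightarrow> x \<in> V \<Longrightarrow> y \<in> V \<Longrightarrow> z \<in> V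
      \<Longrightarrow> T (J x y z) = J (T x) y z + J x (T y) z + J x y (T z)"
    and swap: "\<And>x y z. x \<in> V \<Longrightarrow> y \<in> V \<Longrightarrow> z \<in> V \<Longrightarrow> J x y z = - J y x z"
    and cycle: "\<And>x y z. x \<in> V \<Longrightarrow> y \<in> V \<Longrightarrow> z \<in> V \<Longrightarrow> J x y z = J y z x"
    and xyz: "x \<in> V" "y \<in> V" "z \<in> V"
  shows "J x y z = 0"
proof -
  interpret V: sl2_irrep smul V e h f 6 v by fact
  interpret W: sl2_irrep smul W e h f 2 w by fact
  note J1s = linear_map_onD[OF J1] linear_map_on_zero[OF J1]
  note J2s = linear_map_onD[OF J2] linear_map_on_zero[OF J2]
  note J3s = linear_map_onD[OF J3] linear_map_on_zero[OF J3]
  note eqv = equiv[of e, simplified] equiv[of h, simplified] equiv[of f, simplified]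
  define X where "X k = (f ^^ k) v" for k
  have X: "X k \<in> V" for k unfolding X_def by (rule V.f_power_in[OF V.v0(1)])
  have hX: "h (X k) = smul (6 - 2 * of_nat k) (X k)" for k
    using V.h_f_power[OF V.v0(1,4), of k] by (simp add: X_def)
  have fX: "f (X k) = X (Suc k)" for k by (simp add: X_def)
  have eX: "\<exists>c. e (X k) = smul c (X (k - 1)) \<and> (k = 0 \<longrightarrow> c = 0)" for k
    using V.e_f_power[OF V.v0(1,3,4), of "k - 1"] V.v0(3)
    by (cases k) (auto simp: X_def)
  have X7: "X k = 0" if "k \<ge> 7" for k
    using that V.f_power_vanishes[of k] by (simp add: X_def)
  define G where "G i j k = J (X i) (X j) (X k)" for i j k
  have GW: "G i j k \<in> W" for i j k by (simp add: G_def J1s X)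
  have hG: "h (G i j k) = smul (18 - 2 * of_nat (i + j + k)) (G i j k)" for i j k
  proof -
    have "h (G i j k) = smul (6 - 2 * of_nat i) (G i j k) + smul (6 - 2 * of_nat j) (G i j k)
        + smul (6 - 2 * of_nat k) (G i j k)"
      by (simp add: G_def eqv X hX J1s J2s J3s)
    then show ?thesis unfolding V.scale_left_distrib[symmetric] by (simp add: algebra_simps)
  qed
  have fG: "f (G i j k) = G (Suc i) j k + G i (Suc j) k + G i j (Suc k)" for i j k
    by (simp add: G_def eqv X fX)
  have G_swap: "G i j k = - G j i k" for i j k unfolding G_def by (intro swap X)
  have G_cycle: "G i j k = G j k i" for i j k unfolding G_def by (intro cycle X)
  have G_same: "G i i k = 0" for i k
    using G_swap[of i i k] V.double_eq_0[of "G i i k"] by (simp add: eq_neg_iff_add_eq_0)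
  have G7: "G i j k = 0" if "k \<ge> 7" for i j k
    using X7[OF that] J3s(4)[OF X X V.V_closed(1)] by (simp add: G_def)
  have zero: "i + j + k = s \<Longrightarrow> G i j k = 0" for i j k s
  proof (induction s arbitrary: i j k rule: less_induct)
    case (less s)
    show ?case
    proof (cases "s = 8")
      case True
      have rel: "G (Suc a) b c + G a (Suc b) c + G a b (Suc c) = 0" if "a + b + c = 7" for a b c
        using fG[of a b c] less.IH[of 7 a b c] that True W.f_simps by simp
      \<comment> \<open>Four increasing triples in 0..6 have sum 8, and four have sum 7. Each of the
        latter supplies one relation; this one isolates \<open>G 0 2 6\<close>, since repeated
        indices and the index 7 give zero.\<close>
      have G026: "G 0 2 6 = 0"
        using rel[of 0 1 6] G_same[of 1] G7[of 7] by (simp add: eval_nat_numeral)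
      have 1: "G 1 2 5 + G 0 3 5 = 0"
        using rel[of 0 2 5] G026 by (simp add: eval_nat_numeral)
      have 2: "G 1 3 4 + G 0 3 5 = 0"
        using rel[of 0 3 4] G_same[of 4 0] G_cycle[of 0 4 4] by (simp add: eval_nat_numeral)
      have 3: "G 1 3 4 + G 1 2 5 = 0"
        using rel[of 1 2 4] G_same[of 2 4] by (simp add: eval_nat_numeral)
      \<comment> \<open>The three remaining unknowns have pairwise sums zero, so each of them
        vanishes.\<close>
      have neg: "G 1 2 5 = - G 0 3 5" "G 1 3 4 = - G 0 3 5"
        using 1 2 by (simp_all only: eq_neg_iff_add_eq_0)
      have "- G 0 3 5 = 0" using 3 unfolding neg V.double_eq_0 .
      then have G035: "G 0 3 5 = 0" and G125: "G 1 2 5 = 0" and G134: "G 1 3 4 = 0"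
        by (simp_all only: neg neg_equal_0_iff_equal)
      \<comment> \<open>With total 8 an index above 6 can only be the largest, so \<open>G7\<close>
        is needed for the last argument alone.\<close>
      have sorted: "G i j k = 0" if "i < j" "j < k" "i + j + k = 8" for i j k
      proof (cases "k \<ge> 7")
        case False
        then have "(i, j, k) \<in> {(0, 2, 6), (0, 3, 5), (1, 2, 5), (1, 3, 4)}"
        proof -
          have "i \<in> {0, 1}" "k \<in> {3, 4, 5, 6}" "j = 8 - i - k" using that False by auto
          then show ?thesis using that by auto
        qed
        then show ?thesis using G026 G035 G125 G134 by auto
      qed (rule G7)
      have flip: "G i j k = 0" if "G i k j = 0" for i j k
        using that by (subst G_swap, subst G_cycle) simp
      have ascending: "G i j k = 0" if "i < j" "i + j + k = 8" for i j k
      proof -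
        consider "j < k" | "k = j" | "i < k" "k < j" | "k = i" | "k < i" by linarith
        then show ?thesis
        proof cases
          case 1
          then show ?thesis using sorted[of i j k] that by simp
        next
          case 2
          show ?thesis unfolding 2 by (subst G_cycle) (rule G_same)
        next
          case 3
          then show ?thesis using sorted[of i k j] that by - (rule flip, simp)
        next
          case 4
          show ?thesis unfolding 4 by (rule flip[OF G_same])
        next
          case 5
          then have "G k i j = 0" using sorted that by simp
          then show ?thesis unfolding G_cycle[of k i j] .
        qed
      qed
      have "i + j + k = 8" using less.prems True by simp
      then consider "i < j" "i + j + k = 8" | "i = j" | "j < i" "j + i + k = 8" by linarith
      then show ?thesis
      proof cases
        case 1
        then show ?thesis by (rule ascending)
      next
        case 2
        then show ?thesis using G_same by simp
      next
        case 3
        then show ?thesis by (subst G_swap) (simp add: ascending)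
      qed
    next
      case False
      have "e (G i j k) = 0"
      proof -
        obtain a b c where a: "e (X i) = smul a (X (i - 1))" "i = 0 \<longrightarrow> a = 0"
          and b: "e (X j) = smul b (X (j - 1))" "j = 0 \<longrightarrow> b = 0"
          and c: "e (X k) = smul c (X (k - 1))" "k = 0 \<longrightarrow> c = 0"
          using eX by meson
        have "e (G i j k) = smul a (G (i - 1) j k) + smul b (G i (j - 1) k) + smul c (G i j (k - 1))"
          by (simp add: G_def eqv X J1s J2s J3s a(1) b(1) c(1))
        moreover have "smul a (G (i - 1) j k) = 0"
          using less.IH[of "s - 1" "i - 1" j k] less.prems a(2) by (cases i) auto
        moreover have "smul b (G i (j - 1) k) = 0"
          using less.IH[of "s - 1" i "j - 1" k] less.prems b(2) by (cases j) auto
        moreover have "smul c (G i j (k - 1)) = 0"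
          using less.IH[of "s - 1" i j "k - 1"] less.prems c(2) by (cases k) auto
        ultimately show ?thesis by (simp only: add_0_right)
      qed
      moreover have "18 - 2 * of_nat (i + j + k) \<noteq> (of_nat 2 :: complex)"
      proof
        assume "18 - 2 * of_nat (i + j + k) = (of_nat 2 :: complex)"
        then have "of_nat (2 + 2 * (i + j + k)) = (of_nat 18 :: complex)"
          by (simp add: algebra_simps)
        then have "2 + 2 * (i + j + k) = 18" unfolding of_nat_eq_iff .
        then show False using False less.prems by simp
      qed
      ultimately show ?thesis using W.highest_weight_zero[OF GW _ hG] by blast
    qed
  qed
  have 1: "J (X i) (X j) z = 0" if "z \<in> V" for i j z
    using V.linear_zero_if_zero_on_f_powers[OF J3 V.module_axioms _ that, of "X i" "X j"] X zero
    by (simp add: G_def X_def)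
  have 2: "J (X i) y z = 0" if "y \<in> V" "z \<in> V" for i y z
    using V.linear_zero_if_zero_on_f_powers[OF J2 V.module_axioms _ that(1), of "X i" z] X 1 that
    by (simp add: X_def)
  show ?thesis
    using V.linear_zero_if_zero_on_f_powers[OF J1 V.module_axioms _ xyz(1), of y z] 2 xyz
    by (simp add: X_def)
qed

section \<open>The Lie algebra sl2 and direct sums of modules\<close>

definition sl2_f :: "complex^2^2" where
  "sl2_f = vector [vector [0, 0], vector [1, 0]]"

lemma mat_scale_component: "mat_scale c A $ i $ j = c * A $ i $ j"
  by (simp add: mat_scale_def)

lemma sl2_mem_iff: "A \<in> sl2 \<longleftrightarrow> A $ 1 $ 1 + A $ 2 $ 2 = 0"
  by (simp add: sl2_def trace_def sum_2)

lemmas sl2_matrix_simps = vec_eq_iff forall_2 mat_scale_component sl2_mem_iff sl2_e_def sl2_h_def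
  sl2_f_def commutator_def matrix_matrix_mult_def sum_2

lemma sl2_basis_in_sl2: "sl2_e \<in> sl2" "sl2_h \<in> sl2" "sl2_f \<in> sl2"
  by (simp_all add: sl2_matrix_simps)

lemma sl2_decompose:
  assumes "A \<in> sl2"
  obtains a b c where "A = mat_scale a sl2_e + (mat_scale b sl2_h + mat_scale c sl2_f)"
proof
  show "A = mat_scale (A $ 1 $ 2) sl2_e + (mat_scale (A $ 1 $ 1) sl2_h + mat_scale (A $ 2 $ 1) sl2_f)"
    using assms by (simp add: sl2_matrix_simps add_eq_0_iff)
qed

lemma sl2_brackets:
  "commutator sl2_h sl2_e = mat_scale 2 sl2_e"
  "commutator sl2_h sl2_f = mat_scale (-2) sl2_f"
  "commutator sl2_e sl2_f = sl2_h"
  "commutator sl2_e sl2_h = mat_scale (-2) sl2_e"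
  "commutator sl2_f sl2_h = mat_scale 2 sl2_f"
  "commutator sl2_f sl2_e = mat_scale (-1) sl2_h"
  "commutator A A = 0"
  by (simp_all add: sl2_matrix_simps)

lemma linear_map_on_sl2_ext:
  assumes S: "linear_map_on mat_scale sl2 sb B S" and T: "linear_map_on mat_scale sl2 sb B T"
    and eq: "S sl2_e = T sl2_e" "S sl2_h = T sl2_h" "S sl2_f = T sl2_f"
    and A: "A \<in> sl2"
  shows "S A = T A"
proof -
  interpret sl2: lie_algebra mat_scale sl2 commutator by (rule lie_algebra_sl2)
  note closed = sl2.subspace_scale[OF sl2.subspace_carrier] sl2.subspace_add[OF sl2.subspace_carrier]
    sl2_basis_in_sl2
  obtain a b c where "A = mat_scale a sl2_e + (mat_scale b sl2_h + mat_scale c sl2_f)"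
    using A by (rule sl2_decompose)
  then show ?thesis
    by (simp add: linear_map_onD(2,3)[OF S] linear_map_onD(2,3)[OF T] closed eq)
qed

text \<open>The passage from actions of matrices to three operators: a subspace stable under the
  basis matrices is stable under all of \<open>sl2\<close>, so irreducibility carries over.\<close>

lemma irreducible_sl2_module_imp_sl2_irrep:
  assumes "irreducible_sl2_module smul V act l"
  shows "\<exists>v. sl2_irrep smul V (act sl2_e) (act sl2_h) (act sl2_f) l v"
proof -
  from assms obtain v where mod: "sl2_module smul V act"
    and irr: "lie_module.irreducible sl2 smul V act"
    and v: "v \<in> V" "v \<noteq> 0" "act sl2_e v = 0" "act sl2_h v = smul (of_nat l) v"
    unfolding irreducible_sl2_module_def by blast
  interpret lie_module mat_scale sl2 commutator smul V act by (rule mod)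
  have lin: "linear_map_on smul V smul V (act x)" if "x \<in> sl2" for x
    using act_bilinear that by (simp add: bilinear_map_on_def)
  have lin': "linear_map_on mat_scale sl2 smul V (\<lambda>x. act x u)" if "u \<in> V" for u
    using act_bilinear that by (simp add: bilinear_map_on_def)
  have scale: "act (mat_scale c x) u = smul c (act x u)" if "x \<in> sl2" "u \<in> V" for c x u
    using linear_map_onD(3)[OF lin'[OF that(2)] that(1)] .
  have neg: "act (- x) u = - act x u" if "x \<in> sl2" "u \<in> V" for x u
    using scale[OF that, of "-1"] by simp
  note br = act_bracket[OF sl2_basis_in_sl2(2,1)] act_bracket[OF sl2_basis_in_sl2(2,3)]
    act_bracket[OF sl2_basis_in_sl2(1,3)]
  show ?thesis
  proof (intro exI, unfold_locales)
    show "M.subspace V" by (rule M.subspace_carrier)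
    show "linear_map_on smul V smul V (act sl2_e)" "linear_map_on smul V smul V (act sl2_h)"
      "linear_map_on smul V smul V (act sl2_f)"
      by (intro lin sl2_basis_in_sl2)+
    fix x assume x: "x \<in> V"
    show "act sl2_h (act sl2_e x) = act sl2_e (act sl2_h x) + smul 2 (act sl2_e x)"
      using br(1)[OF x] x by (simp add: sl2_brackets scale neg subspace_scale[OF subspace_carrier] sl2_basis_in_sl2 algebra_simps)
    show "act sl2_h (act sl2_f x) = act sl2_f (act sl2_h x) - smul 2 (act sl2_f x)"
      using br(2)[OF x] x by (simp add: sl2_brackets scale neg subspace_scale[OF subspace_carrier] sl2_basis_in_sl2 algebra_simps)
    show "act sl2_e (act sl2_f x) = act sl2_f (act sl2_e x) + act sl2_h x"
      using br(3)[OF x] x by (simp add: sl2_brackets scale neg subspace_scale[OF subspace_carrier] sl2_basis_in_sl2 algebra_simps)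
  next
    fix W assume W: "M.subspace W" "W \<subseteq> V"
      and closed: "\<And>x. x \<in> W \<Longrightarrow> act sl2_e x \<in> W \<and> act sl2_h x \<in> W \<and> act sl2_f x \<in> W"
    have "act x w \<in> W" if x: "x \<in> sl2" and w: "w \<in> W" for x w
    proof -
      have wV: "w \<in> V" using W w by auto
      obtain a b c where "x = mat_scale a sl2_e + (mat_scale b sl2_h + mat_scale c sl2_f)"
        using x by (rule sl2_decompose)
      then show ?thesis
        using closed[OF w] W(1)
        by (simp add: linear_map_onD(2,3)[OF lin'[OF wV]] sl2_basis_in_sl2
            subspace_scale[OF subspace_carrier] subspace_add[OF subspace_carrier]
            M.subspace_add M.subspace_scale)
    qed
    then have "submodule W" using W by (simp add: submodule_def)
    then show "W = {0} \<or> W = V" using irr by (simp add: irreducible_def)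
  qed (use v in auto)
qed

text \<open>This identifies sl2 with \<open>V\<^sub>2\<close>. It serves both for derivations of sl2
  and for equivariant maps from the nilradical to sl2. From a nonzero matrix at most two brackets
  with \<open>sl2_e\<close> produce a nonzero multiple of \<open>sl2_e\<close>, and
  \<open>sl2_e\<close> generates everything through \<open>sl2_f\<close>.\<close>

lemma adjoint_sl2_irrep:
  "sl2_irrep mat_scale sl2 (commutator sl2_e) (commutator sl2_h) (commutator sl2_f) 2 sl2_e"
proof -
  interpret lie_algebra mat_scale sl2 commutator by (rule lie_algebra_sl2)
  have lin: "linear_map_on mat_scale sl2 mat_scale sl2 (commutator A)" if "A \<in> sl2" for A
    using bracket_bilinear that by (simp add: bilinear_map_on_def)
  show ?thesis
  proof unfold_locales
    show "subspace sl2" by (rule subspace_carrier)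
    show "linear_map_on mat_scale sl2 mat_scale sl2 (commutator sl2_e)"
      "linear_map_on mat_scale sl2 mat_scale sl2 (commutator sl2_h)"
      "linear_map_on mat_scale sl2 mat_scale sl2 (commutator sl2_f)"
      by (intro lin sl2_basis_in_sl2)+
  next
    fix W assume W: "subspace W" "W \<subseteq> sl2"
      and closed: "\<And>x. x \<in> W \<Longrightarrow>
        commutator sl2_e x \<in> W \<and> commutator sl2_h x \<in> W \<and> commutator sl2_f x \<in> W"
    have e_closed: "commutator sl2_e x \<in> W" if "x \<in> W" for x using closed[OF that] by blast
    have unscale: "x \<in> W" if "mat_scale c x \<in> W" "c \<noteq> 0" for c x
      using subspace_scale[OF W(1) that(1), of "inverse c"] that(2) by simp
    show "W = {0} \<or> W = sl2"
    proof (cases "W = {0}")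
      case False
      then obtain x where x: "x \<in> W" "x \<noteq> 0" using subspace_0[OF W(1)] by blast
      then have tr: "x $ 2 $ 2 = - x $ 1 $ 1" using W by (auto simp: sl2_mem_iff add_eq_0_iff)
      have e: "sl2_e \<in> W"
      proof -
        consider "x $ 2 $ 1 \<noteq> 0" | "x $ 2 $ 1 = 0" "x $ 1 $ 1 \<noteq> 0"
          | "x $ 2 $ 1 = 0" "x $ 1 $ 1 = 0" by blast
        then show ?thesis
        proof cases
          case 1
          have "commutator sl2_e (commutator sl2_e x) = mat_scale (-2 * x $ 2 $ 1) sl2_e"
            by (simp add: sl2_matrix_simps)
          then have "mat_scale (-2 * x $ 2 $ 1) sl2_e \<in> W"
            using e_closed[OF e_closed[OF x(1)]] by (simp only:)
          then show ?thesis by (rule unscale) (simp add: 1)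
        next
          case 2
          have "commutator sl2_e x = mat_scale (-2 * x $ 1 $ 1) sl2_e"
            using 2 tr by (simp add: sl2_matrix_simps)
          then have "mat_scale (-2 * x $ 1 $ 1) sl2_e \<in> W"
            using e_closed[OF x(1)] by (simp only:)
          then show ?thesis by (rule unscale) (simp add: 2)
        next
          case 3
          then have "x = mat_scale (x $ 1 $ 2) sl2_e" "x $ 1 $ 2 \<noteq> 0"
            using tr x(2) by (auto simp: sl2_matrix_simps)
          then show ?thesis using x unscale by metis
        qed
      qed
      have h: "sl2_h \<in> W"
        using closed[OF e] unscale[of "-1" sl2_h] unfolding sl2_brackets by simp
      have f: "sl2_f \<in> W"
        using closed[OF h] unscale[of 2 sl2_f] unfolding sl2_brackets by simp
      have "sl2 \<subseteq> W"
      proof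
        fix A assume "A \<in> sl2"
        then obtain a b c where "A = mat_scale a sl2_e + (mat_scale b sl2_h + mat_scale c sl2_f)"
          by (rule sl2_decompose)
        then show "A \<in> W" using W(1) e f h by (simp add: subspace_add subspace_scale)
      qed
      then show ?thesis using W by auto
    qed simp
  qed (auto simp: sl2_matrix_simps algebra_simps)
qed

section \<open>Projections of an internal direct sum\<close>

locale direct_sum = complex_space smul
  for smul :: "complex \<Rightarrow> 'a::ab_group_add \<Rightarrow> 'a" +
  fixes I :: "'i set" and L :: "'i \<Rightarrow> 'a set" and N :: "'a set"
  assumes finite_I: "finite I"
    and is_direct_sum: "internal_direct_sum smul I L N"
begin

lemma subspace_L: "i \<in> I \<Longrightarrow> subspace (L i)"
  and N_eq: "N = {\<Sum>i\<in>I. f i | f. \<forall>i\<in>I. f i \<in> L i}"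
  and independent_L: "\<lbrakk>\<And>i. i \<in> I \<Longrightarrow> f i \<in> L i; (\<Sum>i\<in>I. f i) = 0; i \<in> I\<rbrakk> \<Longrightarrow> f i = 0"
  using is_direct_sum by (simp_all add: internal_direct_sum_def)

definition proj :: "'i \<Rightarrow> 'a \<Rightarrow> 'a" where
  "proj i u = (SOME f. (\<forall>i\<in>I. f i \<in> L i) \<and> u = (\<Sum>i\<in>I. f i)) i"

lemma proj:
  assumes "u \<in> N"
  shows "i \<in> I \<Longrightarrow> proj i u \<in> L i" and "(\<Sum>i\<in>I. proj i u) = u"
proof -
  have "\<exists>f. (\<forall>i\<in>I. f i \<in> L i) \<and> u = (\<Sum>i\<in>I. f i)" using assms N_eq by auto
  from someI_ex[OF this] show "i \<in> I \<Longrightarrow> proj i u \<in> L i" and "(\<Sum>i\<in>I. proj i u) = u"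
    unfolding proj_def by auto
qed

lemma sum_in_N: "(\<And>i. i \<in> I \<Longrightarrow> g i \<in> L i) \<Longrightarrow> (\<Sum>i\<in>I. g i) \<in> N"
  using N_eq by auto

lemma proj_unique:
  assumes "\<And>i. i \<in> I \<Longrightarrow> g i \<in> L i" and "u = (\<Sum>i\<in>I. g i)" and "i \<in> I"
  shows "proj i u = g i"
proof -
  have "u \<in> N" unfolding assms(2) by (rule sum_in_N) (rule assms(1))
  have "proj i u - g i = 0"
  proof (rule independent_L[OF _ _ assms(3)])
    show "proj i u - g i \<in> L i" if "i \<in> I" for i
      using that assms(1) proj(1)[OF \<open>u \<in> N\<close>] subspace_L by (auto intro: subspace_diff)
    show "(\<Sum>i\<in>I. proj i u - g i) = 0"
      using proj(2)[OF \<open>u \<in> N\<close>] assms(2) by (simp add: sum_subtractf)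
  qed
  then show ?thesis by simp
qed

lemma sum_single:
  assumes "j \<in> I"
  shows "(\<Sum>i\<in>I. if i = j then x else 0) = x"
  using finite_I assms by simp

lemma L_subset_N: "j \<in> I \<Longrightarrow> L j \<subseteq> N"
proof
  fix x assume "j \<in> I" "x \<in> L j"
  then have "(\<Sum>i\<in>I. if i = j then x else 0) \<in> N"
    by (intro sum_in_N) (auto simp: subspace_0 subspace_L)
  then show "x \<in> N" unfolding sum_single[OF \<open>j \<in> I\<close>] .
qed

lemma proj_component:
  assumes "j \<in> I" "x \<in> L j" "i \<in> I"
  shows "proj i x = (if i = j then x else 0)"
  using assms by (intro proj_unique) (auto simp: sum_single subspace_0 subspace_L)

lemma subspace_N: "subspace N"
  unfolding subspace_def
proof (intro conjI ballI allI)
  show "0 \<in> N" using sum_in_N[of "\<lambda>_. 0"] by (simp add: subspace_0 subspace_L)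
  fix x assume x: "x \<in> N"
  show "x + y \<in> N" if y: "y \<in> N" for y
  proof -
    have "x + y = (\<Sum>i\<in>I. proj i x + proj i y)"
      by (simp add: sum.distrib proj(2) x y)
    also have "\<dots> \<in> N" by (intro sum_in_N subspace_add subspace_L proj x y)
    finally show ?thesis .
  qed
  show "smul c x \<in> N" for c
  proof -
    have "smul c x = (\<Sum>i\<in>I. smul c (proj i x))"
      by (simp add: proj(2) x flip: scale_sum_right)
    also have "\<dots> \<in> N" by (intro sum_in_N subspace_scale subspace_L proj x)
    finally show ?thesis .
  qed
qed

lemma linear_proj: "i \<in> I \<Longrightarrow> linear_map_on smul N smul (L i) (proj i)"
  unfolding linear_map_on_def
proof (intro conjI ballI allI)
  fix x assume i: "i \<in> I" and x: "x \<in> N"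
  show "proj i x \<in> L i" using i x by (rule proj(1)[rotated])
  show "proj i (x + y) = proj i x + proj i y" if y: "y \<in> N" for y
    using i by (intro proj_unique subspace_add subspace_L proj x y)
      (simp_all add: sum.distrib proj(2) x y)
  show "proj i (smul c x) = smul c (proj i x)" for c
    using i by (intro proj_unique subspace_scale subspace_L proj x)
      (simp_all add: proj(2) x flip: scale_sum_right)
qed

lemma linear_map_on_component:
  "linear_map_on smul N sb B T \<Longrightarrow> i \<in> I \<Longrightarrow> linear_map_on smul (L i) sb B T"
  using L_subset_N by (auto simp: linear_map_on_def subset_iff)

lemma linear_sum_proj:
  assumes T: "linear_map_on smul N sb B T" and u: "u \<in> N"
  shows "T u = (\<Sum>i\<in>I. T (proj i u))"
proof -
  have "T (\<Sum>i\<in>I. proj i u) = (\<Sum>i\<in>I. T (proj i u))"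
    using L_subset_N proj(1)[OF u]
    by (intro linear_map_on_sum[OF T module_axioms subspace_N]) blast
  then show ?thesis by (simp add: proj(2)[OF u])
qed

lemma linear_zero_on_N:
  assumes T: "linear_map_on smul N sb B T"
    and zero: "\<And>i x. i \<in> I \<Longrightarrow> x \<in> L i \<Longrightarrow> T x = 0" and u: "u \<in> N"
  shows "T u = 0"
  unfolding linear_sum_proj[OF T u] by (intro sum.neutral ballI zero[OF _ proj(1)[OF u]])

lemma linear_eq_on_N:
  assumes S: "linear_map_on smul N smul B S" and T: "linear_map_on smul N smul B T"
    and eq: "\<And>i x. i \<in> I \<Longrightarrow> x \<in> L i \<Longrightarrow> S x = T x" and u: "u \<in> N"
  shows "S u = T u"
  unfolding linear_sum_proj[OF T u] linear_sum_proj[OF S u]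
  by (intro sum.cong refl eq[OF _ proj(1)[OF u]])

text \<open>Applying \<open>T\<close> termwise to the decomposition of \<open>u\<close> gives a
  decomposition of \<open>T u\<close>, and decompositions are unique.\<close>

lemma proj_commute:
  assumes T: "linear_map_on smul N smul B T"
    and invariant: "\<And>i x. i \<in> I \<Longrightarrow> x \<in> L i \<Longrightarrow> T x \<in> L i" and u: "u \<in> N" and i: "i \<in> I"
  shows "proj i (T u) = T (proj i u)"
  using i by (intro proj_unique linear_sum_proj[OF T u] invariant proj u)

end

section \<open>Derivations, Whitehead's lemma for sl2, and semidirect products\<close>

context lie_algebra
begin

lemma bracket_linear:
  shows "x \<in> g \<Longrightarrow> linear_map_on smul g smul g (bracket x)"
    and "y \<in> g \<Longrightarrow> linear_map_on smul g smul g (\<lambda>x. bracket x y)"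
  using bracket_bilinear by (simp_all add: bilinear_map_on_def)

lemma bracket_anti:
  assumes "x \<in> g" "y \<in> g"
  shows "bracket x y = - bracket y x"
proof -
  have self: "bracket x x = 0" if "x \<in> g" for x
    using bracket_alternating that by (simp add: alternating_on_def)
  show ?thesis
    using self[OF subspace_add[OF subspace_carrier assms]] self[OF assms(1)] self[OF assms(2)] assms
    by (simp add: linear_map_onD(2)[OF bracket_linear(1)] linear_map_onD(2)[OF bracket_linear(2)]
        subspace_add[OF subspace_carrier] eq_neg_iff_add_eq_0 add.commute)
qed

text \<open>The Leibniz rule for \<open>bracket a\<close> is the Jacobi identity. This is the
  correction step that makes a derivation vanish on sl2.\<close>

lemma derivation_minus_inner:
  assumes D: "derivation D" and a: "a \<in> g"
  shows "derivation (\<lambda>x. D x - bracket a x)"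
  unfolding derivation_def
proof (intro conjI ballI)
  have lin: "linear_map_on smul g smul g D"
    and leibniz: "\<And>x y. x \<in> g \<Longrightarrow> y \<in> g \<Longrightarrow> D (bracket x y) = bracket (D x) y + bracket x (D y)"
    using D by (auto simp: derivation_def)
  note simps = linear_map_onD[OF lin] linear_map_onD[OF bracket_linear(1)]
    linear_map_onD[OF bracket_linear(2)]
  show "linear_map_on smul g smul g (\<lambda>x. D x - bracket a x)"
    unfolding linear_map_on_def
    using a by (simp add: simps subspace_diff[OF subspace_carrier] scale_right_diff_distrib)
  fix x y assume xy: "x \<in> g" "y \<in> g"
  have 1: "bracket y (bracket a x) = - bracket (bracket a x) y"
    and 2: "bracket x (bracket y a) = - bracket x (bracket a y)"
  proof -
    show "bracket y (bracket a x) = - bracket (bracket a x) y"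
      by (intro bracket_anti simps xy a)
    have "bracket x (smul (-1) (bracket a y)) = smul (-1) (bracket x (bracket a y))"
      using xy a by (simp only: simps)
    then show "bracket x (bracket y a) = - bracket x (bracket a y)"
      using bracket_anti[OF xy(2) a] by simp
  qed
  have "bracket a (bracket x y) = bracket (bracket a x) y + bracket x (bracket a y)"
    using jacobi[OF a xy] unfolding 1 2 by (simp add: algebra_simps add_eq_0_iff)
  then show "D (bracket x y) - bracket a (bracket x y)
      = bracket (D x - bracket a x) y + bracket x (D y - bracket a y)"
    using xy a
    by (simp add: leibniz simps linear_map_on_diff[OF bracket_linear(1) module_axioms subspace_carrier]
        linear_map_on_diff[OF bracket_linear(2) module_axioms subspace_carrier])
qed

end

text \<open>A derivation of sl2 is a 1-cocycle with values in the adjoint module, hence a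
  coboundary. The coboundary has the form \<open>commutator x a\<close>, so the inner element is
  \<open>- a\<close>.\<close>

lemma derivation_sl2_inner:
  assumes b: "linear_map_on mat_scale sl2 mat_scale sl2 b"
    and leibniz: "\<And>x y. x \<in> sl2 \<Longrightarrow> y \<in> sl2
      \<Longrightarrow> b (commutator x y) = commutator (b x) y + commutator x (b y)"
  shows "\<exists>a\<in>sl2. \<forall>x\<in>sl2. b x = commutator a x"
proof -
  interpret sl2_irrep mat_scale sl2 "commutator sl2_e" "commutator sl2_h" "commutator sl2_f" 2 sl2_e
    by (rule adjoint_sl2_irrep)
  interpret lie_algebra mat_scale sl2 commutator by (rule lie_algebra_sl2)
  note basis = sl2_basis_in_sl2
  note b_in = linear_map_onD(1)[OF b]
  have cocycle: "b (commutator x y) = commutator x (b y) - commutator y (b x)"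
    if "x \<in> sl2" "y \<in> sl2" for x y
    using leibniz[OF that] bracket_anti[OF b_in[OF that(1)] that(2)] by simp
  have "\<exists>a\<in>sl2. commutator sl2_e a = b sl2_e \<and> commutator sl2_h a = b sl2_h
      \<and> commutator sl2_f a = b sl2_f"
  proof (rule cocycle_is_coboundary)
    show "commutator sl2_e (b sl2_f) = b sl2_h + commutator sl2_f (b sl2_e)"
      using cocycle[OF basis(1,3)] unfolding sl2_brackets by simp
    show "commutator sl2_h (b sl2_e) = commutator sl2_e (b sl2_h) + mat_scale 2 (b sl2_e)"
      using cocycle[OF basis(2,1)] unfolding sl2_brackets linear_map_onD(3)[OF b basis(1)]
      by (simp add: algebra_simps)
    show "commutator sl2_h (b sl2_f) = commutator sl2_f (b sl2_h) - mat_scale 2 (b sl2_f)"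
      using cocycle[OF basis(2,3)] unfolding sl2_brackets linear_map_onD(3)[OF b basis(3)]
      by (simp add: algebra_simps)
  qed (intro b_in basis)+
  then obtain a where a: "a \<in> sl2" "commutator sl2_e a = b sl2_e" "commutator sl2_h a = b sl2_h"
    "commutator sl2_f a = b sl2_f" by blast
  have b_eq: "b x = commutator x a" if "x \<in> sl2" for x
    by (rule linear_map_on_sl2_ext[OF b bracket_linear(2)[OF a(1)] _ _ _ that]) (simp_all add: a)
  have "commutator x a = commutator (- a) x" for x
    by (simp add: commutator_def matrix_matrix_mult_def vec_eq_iff sum_2 algebra_simps)
  with b_eq a(1) show ?thesis
    using subspace_neg[OF subspace_carrier a(1)] by auto
qed

lemma semidirect_lie_algebra:
  assumes mod: "lie_module sg g bg smul N act" and N: "lie_algebra smul N br"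
    and equiv: "\<And>x u v. \<lbrakk>x \<in> g; u \<in> N; v \<in> N\<rbrakk>
      \<Longrightarrow> act x (br u v) = br (act x u) v + br u (act x v)"
  shows "lie_algebra (prod_scale sg smul) (g \<times> N) (semidirect_bracket bg act br)"
proof -
  interpret lie_module sg g bg smul N act by (rule mod)
  interpret N: lie_algebra smul N br by (rule N)
  interpret P: vector_space "prod_scale sg smul"
    by unfold_locales
      (auto simp: prod_scale_def scale_left_distrib scale_right_distrib
        M.scale_left_distrib M.scale_right_distrib)
  note g_closed = subspace_0[OF subspace_carrier] subspace_add[OF subspace_carrier]
    subspace_diff[OF subspace_carrier] subspace_scale[OF subspace_carrier]
  note N_closed = M.subspace_0[OF M.subspace_carrier] M.subspace_add[OF M.subspace_carrier]
    M.subspace_diff[OF M.subspace_carrier] M.subspace_scale[OF M.subspace_carrier]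
  have bg1: "linear_map_on sg g sg g (bg x)" if "x \<in> g" for x
    using bracket_bilinear that by (simp add: bilinear_map_on_def)
  have bg2: "linear_map_on sg g sg g (\<lambda>x. bg x y)" if "y \<in> g" for y
    using bracket_bilinear that by (simp add: bilinear_map_on_def)
  have br1: "linear_map_on smul N smul N (br x)" if "x \<in> N" for x
    using N.bracket_bilinear that by (simp add: bilinear_map_on_def)
  have br2: "linear_map_on smul N smul N (\<lambda>x. br x y)" if "y \<in> N" for y
    using N.bracket_bilinear that by (simp add: bilinear_map_on_def)
  have act1: "linear_map_on smul N smul N (act x)" if "x \<in> g" for x
    using act_bilinear that by (simp add: bilinear_map_on_def)
  have act2: "linear_map_on sg g smul N (\<lambda>x. act x u)" if "u \<in> N" for u
    using act_bilinear that by (simp add: bilinear_map_on_def)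
  note lin = linear_map_onD[OF bg1] linear_map_onD[OF bg2] linear_map_onD[OF br1]
    linear_map_onD[OF br2] linear_map_onD[OF act1] linear_map_onD[OF act2]
  have br_self: "br u u = 0" if "u \<in> N" for u
    using N.bracket_alternating that by (simp add: alternating_on_def)
  have anti: "br u v = - br v u" if "u \<in> N" "v \<in> N" for u v
    using br_self[of "u + v"] br_self[of u] br_self[of v] that
    by (simp add: lin N_closed eq_neg_iff_add_eq_0 add.commute)
  show ?thesis
  proof unfold_locales
    show "P.subspace (g \<times> N)"
      unfolding P.subspace_def by (auto simp: prod_scale_def zero_prod_def g_closed N_closed)
  next
    obtain B C where B: "finite B" "span B = g" and C: "finite C" "M.span C = N"
      using finite_dimensional M.finite_dimensional by blast
    let ?S = "(\<lambda>b. (b, 0)) ` B \<union> (\<lambda>c. (0, c)) ` C"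
    have "P.span ?S = g \<times> N"
    proof
      have "B \<subseteq> g" "C \<subseteq> N" using B C span_superset M.span_superset by auto
      then have "?S \<subseteq> g \<times> N" using g_closed N_closed by auto
      moreover have "P.subspace (g \<times> N)"
        unfolding P.subspace_def by (auto simp: prod_scale_def zero_prod_def g_closed N_closed)
      ultimately show "P.span ?S \<subseteq> g \<times> N" by (rule P.span_minimal)
      show "g \<times> N \<subseteq> P.span ?S"
      proof clarify
        fix x u assume "x \<in> g" "u \<in> N"
        have "(x, 0) \<in> P.span ?S"
          using \<open>x \<in> g\<close> unfolding B(2)[symmetric]
        proof (induction rule: span_induct_alt)
          case base
          show ?case using P.span_zero by (simp add: zero_prod_def)
        next
          case (step c b y)
          have eq: "(sg c b + y, 0) = prod_scale sg smul c (b, 0) + (y, 0)"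
            by (simp add: prod_scale_def)
          show ?case unfolding eq
            using step by (auto intro!: P.span_add P.span_scale intro: P.span_base)
        qed
        moreover have "(0, u) \<in> P.span ?S"
          using \<open>u \<in> N\<close> unfolding C(2)[symmetric]
        proof (induction rule: M.span_induct_alt)
          case base
          show ?case using P.span_zero by (simp add: zero_prod_def)
        next
          case (step c b y)
          have eq: "(0, smul c b + y) = prod_scale sg smul c (0, b) + (0, y)"
            by (simp add: prod_scale_def)
          show ?case unfolding eq
            using step by (auto intro!: P.span_add P.span_scale intro: P.span_base)
        qed
        ultimately have "(x, 0) + (0, u) \<in> P.span ?S" by (rule P.span_add)
        then show "(x, u) \<in> P.span ?S" by simp
      qed
    qed
    then show "\<exists>B. finite B \<and> P.span B = g \<times> N" using B C by (intro exI[of _ ?S]) simp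
  next
    show "bilinear_map_on (prod_scale sg smul) (g \<times> N) (prod_scale sg smul) (g \<times> N)
        (prod_scale sg smul) (g \<times> N) (semidirect_bracket bg act br)"
      unfolding bilinear_map_on_def linear_map_on_def semidirect_bracket_def prod_scale_def
      by (auto simp: lin N_closed g_closed M.scale_right_distrib M.scale_right_diff_distrib)
  next
    show "alternating_on (g \<times> N) (semidirect_bracket bg act br)"
      using bracket_alternating
      by (auto simp: alternating_on_def semidirect_bracket_def br_self zero_prod_def)
  next
    fix p q r assume "p \<in> g \<times> N" "q \<in> g \<times> N" "r \<in> g \<times> N"
    then obtain x u y v z w where pqr: "p = (x, u)" "q = (y, v)" "r = (z, w)"
      and mem: "x \<in> g" "y \<in> g" "z \<in> g" "u \<in> N" "v \<in> N" "w \<in> N" by auto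
    \<comment> \<open>Normal forms for the terms left in the second component once
      \<open>double\<close> has expanded actions on brackets: mixed terms get the acted vector on
      the left, and one pure \<open>br\<close> term is eliminated by the Jacobi identity of
      \<open>N\<close>, so that the cyclic sum cancels.\<close>
    have 1: "br w (act x v) = - br (act x v) w" "br u (act y w) = - br (act y w) u"
      "br v (act z u) = - br (act z u) v"
      by (intro anti lin mem)+
    have 2: "br u (br v w) = - (br v (br w u) + br w (br u v))"
      using N.jacobi[OF mem(4,5,6)] by (simp only: eq_neg_iff_add_eq_0 add.assoc)
    have double: "semidirect_bracket bg act br (x, u) (semidirect_bracket bg act br (y, v) (z, w)) =
        (bg x (bg y z), act x (act y w) - act x (act z v) + (br (act x v) w + br v (act x w))
          - (act y (act z u) - act z (act y u)) + (br u (act y w) - br u (act z v) + br u (br v w)))"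
      if "x \<in> g" "y \<in> g" "z \<in> g" "u \<in> N" "v \<in> N" "w \<in> N" for x y z u v w
      using that
      by (simp add: semidirect_bracket_def lin N_closed act_bracket equiv
          linear_map_on_diff[OF act1 M.module_axioms M.subspace_carrier]
          linear_map_on_diff[OF br1 M.module_axioms M.subspace_carrier])
    show "semidirect_bracket bg act br p (semidirect_bracket bg act br q r) +
          semidirect_bracket bg act br q (semidirect_bracket bg act br r p) +
          semidirect_bracket bg act br r (semidirect_bracket bg act br p q) = 0"
      using jacobi[OF mem(1,2,3)]
      by (simp add: pqr double mem zero_prod_def 1 2)
  qed
qed

section \<open>The Jacobi identity on the nilradical\<close>

locale sl2_nilradical =
  fixes n :: nat and r :: "nat \<Rightarrow> nat"
    and smul :: "complex \<Rightarrow> 'a::ab_group_add \<Rightarrow> 'a"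
    and N :: "'a set" and L :: "nat \<Rightarrow> 'a set"
    and act :: "complex^2^2 \<Rightarrow> 'a \<Rightarrow> 'a"
    and br :: "'a \<Rightarrow> 'a \<Rightarrow> 'a"
  assumes n: "n \<ge> 6"
    and r_ge: "\<forall>j\<in>{7..n}. r j \<ge> 4"
    and r_distinct: "inj_on r {7..n}"
    and N_module: "sl2_module smul N act"
    and N_sum: "internal_direct_sum smul {1..n} L N"
    and L_irreducible:
      "\<forall>i\<in>{1..n}. irreducible_sl2_module smul (L i) act (highest_weight r i)"
    and br_bilinear: "bilinear_map_on smul N smul N smul N br"
    and br_alternating: "alternating_on N br"
    and prod_1_2: "sl2_product smul act br (L 1) (L 2) (L 3)"
    and prod_2_2: "sl2_product smul act br (L 2) (L 2) (L 5)"
    and prod_2_4: "sl2_product smul act br (L 2) (L 4) (L 6)"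
    and prod_2_5: "sl2_product smul act br (L 2) (L 5) (L 6)"
    and prod_4_4: "sl2_product smul act br (L 4) (L 4) {u + v | u v. u \<in> L 6 \<and> v \<in> L 3}"
    and prod_k_k: "\<forall>k\<in>{7..n}. sl2_product smul act br (L k) (L k) (L 6)"
    and prod_other:
      "\<forall>i\<in>{1..n}. \<forall>j\<in>{i..n}.
         (i, j) \<notin> {(1, 2), (2, 2), (2, 4), (2, 5), (4, 4)} \<union> {(k, k) | k. k \<in> {7..n}} \<longrightarrow>
         (\<forall>x\<in>L i. \<forall>y\<in>L j. br x y = 0)"
begin

declare One_nat_def [simp del]

sublocale direct_sum smul "{1..n}" L N
proof -
  interpret lie_module mat_scale sl2 commutator smul N act by (rule N_module)
  show "direct_sum smul {1..n} L N" by unfold_locales (simp_all only: N_sum finite_atLeastAtMost)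
qed

sublocale N: lie_module mat_scale sl2 commutator smul N act
  by (rule N_module)

lemmas N_closed = subspace_0[OF subspace_N] subspace_add[OF subspace_N]
  subspace_diff[OF subspace_N] subspace_scale[OF subspace_N]

lemma act_linear:
  shows "x \<in> sl2 \<Longrightarrow> linear_map_on smul N smul N (act x)"
    and "u \<in> N \<Longrightarrow> linear_map_on mat_scale sl2 smul N (\<lambda>x. act x u)"
  using N.act_bilinear by (simp_all add: bilinear_map_on_def)

lemma br_linear:
  shows "u \<in> N \<Longrightarrow> linear_map_on smul N smul N (br u)"
    and "v \<in> N \<Longrightarrow> linear_map_on smul N smul N (\<lambda>u. br u v)"
  using br_bilinear by (simp_all add: bilinear_map_on_def)

lemmas act_simps = linear_map_onD[OF act_linear(1)] linear_map_onD[OF act_linear(2)]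
  linear_map_on_zero[OF act_linear(1) N_closed(1)]
  linear_map_on_zero[OF act_linear(2) N.subspace_0[OF N.subspace_carrier]]
  linear_map_on_diff[OF act_linear(1) module_axioms subspace_N]

lemmas br_simps = linear_map_onD[OF br_linear(1)] linear_map_onD[OF br_linear(2)]
  linear_map_on_zero[OF br_linear(1) N_closed(1)] linear_map_on_zero[OF br_linear(2) N_closed(1)]
  linear_map_on_diff[OF br_linear(1) module_axioms subspace_N]
  linear_map_on_diff[OF br_linear(2) module_axioms subspace_N]

lemma br_self: "u \<in> N \<Longrightarrow> br u u = 0"
  using br_alternating by (simp add: alternating_on_def)

lemma br_anti:
  assumes "u \<in> N" "v \<in> N"
  shows "br u v = - br v u"
  using br_self[of "u + v"] br_self[of u] br_self[of v] assms
  by (simp add: br_simps N_closed eq_neg_iff_add_eq_0 add.commute)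

lemma in_N: "x \<in> L i \<Longrightarrow> i \<in> {1..n} \<Longrightarrow> x \<in> N"
  using L_subset_N by blast

lemma small_indices: "1 \<in> {1..n}" "2 \<in> {1..n}" "3 \<in> {1..n}" "4 \<in> {1..n}" "5 \<in> {1..n}" "6 \<in> {1..n}"
  using n by auto

lemma small_in_N:
  "x \<in> L 1 \<Longrightarrow> x \<in> N" "x \<in> L 2 \<Longrightarrow> x \<in> N" "x \<in> L 3 \<Longrightarrow> x \<in> N" "x \<in> L 4 \<Longrightarrow> x \<in> N"
  "x \<in> L 5 \<Longrightarrow> x \<in> N" "x \<in> L 6 \<Longrightarrow> x \<in> N"
  using in_N small_indices by blast+

lemma act_in_L:
  assumes "x \<in> sl2" "i \<in> {1..n}" "u \<in> L i"
  shows "act x u \<in> L i"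
proof -
  interpret Li: lie_module mat_scale sl2 commutator smul "L i" act
    using L_irreducible assms(2) by (auto simp: irreducible_sl2_module_def)
  show ?thesis using Li.act_bilinear assms by (auto simp: bilinear_map_on_def linear_map_on_def)
qed

definition hw_vector :: "nat \<Rightarrow> 'a" where
  "hw_vector i = (SOME v. sl2_irrep smul (L i) (act sl2_e) (act sl2_h) (act sl2_f) (highest_weight r i) v)"

lemma irrep:
  assumes "i \<in> {1..n}"
  shows "sl2_irrep smul (L i) (act sl2_e) (act sl2_h) (act sl2_f) (highest_weight r i) (hw_vector i)"
  unfolding hw_vector_def
  by (rule someI_ex) (use L_irreducible assms irreducible_sl2_module_imp_sl2_irrep in blast)

lemma highest_weight_small:
  "highest_weight r 1 = 0" "highest_weight r (Suc 0) = 0" "highest_weight r 2 = 6"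
  "highest_weight r 3 = 6" "highest_weight r 4 = 4" "highest_weight r 5 = 6"
  "highest_weight r 6 = 2"
  by (simp_all add: highest_weight_def)

text \<open>The first six weights are 0, 6, 6, 4, 6, 2, and the others are distinct and at least 8.
  This is the input to Schur's lemma: only the three copies of \<open>V\<^sub>6\<close> can be
  mixed.\<close>

lemma highest_weight_eq:
  assumes "i \<in> {1..n}" "j \<in> {1..n}" "highest_weight r i = highest_weight r j"
  shows "i = j \<or> {i, j} \<subseteq> {2, 3, 5}"
proof -
  have small: "i \<in> {1,2,3,4,5,6}" if "i \<in> {1..n}" "i < 7" for i using that by auto
  have large: "highest_weight r i = 2 * r i \<and> r i \<ge> 4" if "i \<in> {1..n}" "\<not> i < 7" for i
    using that r_ge by (auto simp: highest_weight_def)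
  consider "i < 7" "j < 7" | "i < 7" "\<not> j < 7" | "\<not> i < 7" "j < 7" | "\<not> i < 7" "\<not> j < 7"
    by blast
  then show ?thesis
  proof cases
    case 1
    then show ?thesis
      using small[OF assms(1)] small[OF assms(2)] assms(3)
      by (auto simp: highest_weight_def)
  next
    case 2
    then show ?thesis
      using small[OF assms(1)] large[OF assms(2)] assms(3) by (auto simp: highest_weight_def)
  next
    case 3
    then show ?thesis
      using small[OF assms(2)] large[OF assms(1)] assms(3) by (auto simp: highest_weight_def)
  next
    case 4
    then have "r i = r j" using large assms by simp
    then show ?thesis using r_distinct 4 assms by (auto simp: inj_on_def)
  qed
qed

section \<open>The multiplication table of the nilradical\<close>

definition product_pairs :: "(nat \<times> nat) set" where
  "product_pairs = {(1, 2), (2, 2), (2, 4), (2, 5), (4, 4)} \<union> {(k, k) | k. k \<in> {7..n}}"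

lemma product_pairsD:
  assumes "(i, j) \<in> product_pairs"
  shows "\<exists>C. sl2_product smul act br (L i) (L j) C"
proof -
  consider "i = 1" "j = 2" | "i = 2" "j = 2" | "i = 2" "j = 4" | "i = 2" "j = 5"
    | "i = 4" "j = 4" | "i = j" "j \<in> {7..n}"
    using assms by (auto simp: product_pairs_def)
  then show ?thesis
  proof cases
    case 1
    then show ?thesis using prod_1_2 by metis
  next
    case 2
    then show ?thesis using prod_2_2 by metis
  next
    case 3
    then show ?thesis using prod_2_4 by metis
  next
    case 4
    then show ?thesis using prod_2_5 by metis
  next
    case 5
    then show ?thesis using prod_4_4 by metis
  next
    case 6
    then show ?thesis using prod_k_k by metis
  qed
qed

lemma br_zero:
  assumes "i \<in> {1..n}" "j \<in> {1..n}" "(i, j) \<notin> product_pairs" "(j, i) \<notin> product_pairs"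
    and "x \<in> L i" "y \<in> L j"
  shows "br x y = 0"
proof (cases "i \<le> j")
  case True
  then show ?thesis
    using prod_other[folded product_pairs_def, rule_format, of i j x y] assms by simp
next
  case False
  then have "br y x = 0"
    using prod_other[folded product_pairs_def, rule_format, of j i y x] assms by simp
  then show ?thesis using br_anti[OF in_N[OF assms(5,1)] in_N[OF assms(6,2)]] by simp
qed

lemma product_mem:
  assumes "sl2_product smul act br A B C" "u \<in> A" "v \<in> B"
  shows "br u v \<in> C"
proof -
  have "linear_map_on smul B smul C (br u)"
    using assms by (simp add: sl2_product_def bilinear_map_on_def)
  then show ?thesis using assms(3) by (rule linear_map_onD(1))
qed

lemma product_nonzero:
  assumes "sl2_product smul act br A B C" "C \<noteq> {0}"
  shows "\<exists>u\<in>A. \<exists>v\<in>B. br u v \<noteq> 0"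
proof (rule ccontr)
  assume "\<not> ?thesis"
  then have "{br u v |u v. u \<in> A \<and> v \<in> B} \<subseteq> {0}" by auto
  then have "span {br u v |u v. u \<in> A \<and> v \<in> B} \<subseteq> {0}" by (rule span_minimal) (simp add: subspace_def)
  then have "C \<subseteq> {0}" using assms(1) by (simp add: sl2_product_def)
  moreover have "0 \<in> C" using assms(1) span_zero by (auto simp: sl2_product_def)
  ultimately show False using assms(2) by auto
qed

text \<open>With a derivation as \<open>T\<close>, this turns every entry of the multiplication
  table into a linear relation between eigenvalues.\<close>

lemma product_eigenvalue:
  assumes prod: "sl2_product smul act br A B C" and "A \<subseteq> N" "B \<subseteq> N"
    and T: "linear_map_on smul N smul N T"
    and eig: "\<And>u v. u \<in> A \<Longrightarrow> v \<in> B \<Longrightarrow> T (br u v) = smul c (br u v)" and w: "w \<in> C"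
  shows "T w = smul c w"
proof -
  have lin: "linear_map_on smul N smul N (\<lambda>w. T w - smul c w)"
    unfolding linear_map_on_def by (simp add: linear_map_onD[OF T] N_closed algebra_simps)
  have "T w - smul c w = 0"
  proof (rule linear_zero_on_span[OF lin module_axioms subspace_N])
    show "w \<in> span {br u v | u v. u \<in> A \<and> v \<in> B}" using prod w by (simp add: sl2_product_def)
    show "{br u v | u v. u \<in> A \<and> v \<in> B} \<subseteq> N"
      using assms(2,3) by (auto intro!: br_simps)
  qed (auto simp: eig)
  then show ?thesis by simp
qed

text \<open>The table grants equivariance only pair by pair. For pairs outside it all three terms
  vanish, because each \<open>L i\<close> is stable under sl2; bilinearity does the rest.\<close>

lemma act_br:
  assumes x: "x \<in> sl2" and u: "u \<in> N" and v: "v \<in> N"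
  shows "act x (br u v) = br (act x u) v + br u (act x v)"
proof -
  let ?D = "\<lambda>u v. act x (br u v) - (br (act x u) v + br u (act x v))"
  have lin1: "linear_map_on smul N smul N (\<lambda>u. ?D u v)" if "v \<in> N" for v
    using that x unfolding linear_map_on_def by (simp add: act_simps br_simps N_closed algebra_simps)
  have lin2: "linear_map_on smul N smul N (?D u)" if "u \<in> N" for u
    using that x unfolding linear_map_on_def by (simp add: act_simps br_simps N_closed algebra_simps)
  have pair: "?D u v = 0" if "(i, j) \<in> product_pairs" "u \<in> L i" "v \<in> L j" for i j u v
    using product_pairsD[OF that(1)] that x by (auto simp: sl2_product_def)
  have "?D u v = 0" if i: "i \<in> {1..n}" and j: "j \<in> {1..n}" and u: "u \<in> L i" and v: "v \<in> L j" for i j u v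
  proof -
    have N: "u \<in> N" "v \<in> N" using in_N i j u v by auto
    consider "(i, j) \<in> product_pairs" | "(j, i) \<in> product_pairs"
      | "(i, j) \<notin> product_pairs" "(j, i) \<notin> product_pairs" by blast
    then show ?thesis
    proof cases
      case 1
      then show ?thesis using pair u v by blast
    next
      case 2
      have "?D u v = - ?D v u"
      proof -
        have "act x (smul (-1) (br v u)) = smul (-1) (act x (br v u))"
          using x N by (simp only: act_simps br_simps)
        then have "act x (br u v) = - act x (br v u)" using br_anti[OF N] by simp
        moreover have "br (act x u) v = - br v (act x u)" "br u (act x v) = - br (act x v) u"
          using x N by (auto intro!: br_anti act_simps)
        ultimately show ?thesis by simp
      qed
      then show ?thesis using pair[OF 2 v u] by simp
    next
      case 3
      then show ?thesis
        using br_zero[OF i j 3] u v act_in_L[OF x i u] act_in_L[OF x j v] x by (simp add: act_simps)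
    qed
  qed
  then have "?D u v = 0" if "i \<in> {1..n}" "u \<in> L i" for i u
    using linear_zero_on_N[OF lin2 _ v] that in_N by blast
  then have "?D u v = 0"
    using linear_zero_on_N[OF lin1[OF v] _ u] by blast
  then show ?thesis by simp
qed

text \<open>The indices 3 and 6 occur in no pair of the table, so \<open>L 3\<close> and
  \<open>L 6\<close> are central in \<open>N\<close>.\<close>

lemma br_central:
  assumes "k \<in> {3, 6}" "u \<in> N" "w \<in> L k"
  shows "br u w = 0"
proof -
  have k: "k \<in> {1..n}" using assms(1) small_indices by auto
  have lin: "linear_map_on smul N smul N (\<lambda>u. br u w)" by (rule br_linear(2)[OF in_N[OF assms(3) k]])
  show ?thesis
  proof (rule linear_zero_on_N[OF lin _ assms(2)])
    fix i x assume "i \<in> {1..n}" "x \<in> L i"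
    then show "br x w = 0"
      using br_zero[OF _ k _ _ _ assms(3), of i x] assms(1) by (auto simp: product_pairs_def)
  qed
qed

text \<open>Every product lands in the central part \<open>L 3\<close> + \<open>L 6\<close> or in
  \<open>L 5\<close>. The latter arises only from [L_2, L_2] and is bracketed nontrivially only by
  \<open>L 2\<close>.\<close>

lemma br_br_zero:
  assumes x: "i \<in> {1..n}" "x \<in> L i" and y: "j \<in> {1..n}" "y \<in> L j" and z: "k \<in> {1..n}" "z \<in> L k"
    and not_2: "\<not> (i = 2 \<and> j = 2 \<and> k = 2)"
  shows "br x (br y z) = 0"
proof -
  note xN = in_N[OF x(2,1)] and yN = in_N[OF y(2,1)] and zN = in_N[OF z(2,1)]
  have pair: "br x (br y z) = 0"
    if jk: "(j, k) \<in> product_pairs" and not_2: "\<not> (i = 2 \<and> j = 2 \<and> k = 2)"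
      and y: "y \<in> L j" and z: "z \<in> L k" for j k y z
  proof -
    consider "j = 1" "k = 2" | "j = 2" "k = 2" | "j = 2" "k = 4" | "j = 2" "k = 5"
      | "j = 4" "k = 4" | "j = k" "k \<in> {7..n}"
      using jk by (auto simp: product_pairs_def)
    then show ?thesis
    proof cases
      case 1
      then show ?thesis using product_mem[OF prod_1_2] y z br_central[of 3] xN by simp
    next
      case 2
      then have "br y z \<in> L 5" using product_mem[OF prod_2_2] y z by simp
      moreover have "i \<noteq> 2" using 2 not_2 by simp
      ultimately show ?thesis
        using br_zero[OF x(1) small_indices(5) _ _ x(2)] by (auto simp: product_pairs_def)
    next
      case 3
      then show ?thesis using product_mem[OF prod_2_4] y z br_central[of 6] xN by simp
    next
      case 4
      then show ?thesis using product_mem[OF prod_2_5] y z br_central[of 6] xN by simp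
    next
      case 5
      then obtain u v where "br y z = u + v" "u \<in> L 6" "v \<in> L 3"
        using product_mem[OF prod_4_4] y z by blast
      then show ?thesis
        using br_central[of 6 x u] br_central[of 3 x v] xN by (simp add: br_simps small_in_N)
    next
      case 6
      then show ?thesis using product_mem[of "L k" "L k" "L 6" y z] prod_k_k y z br_central[of 6] xN by simp
    qed
  qed
  consider "(j, k) \<in> product_pairs" | "(k, j) \<in> product_pairs"
    | "(j, k) \<notin> product_pairs" "(k, j) \<notin> product_pairs" by blast
  then show ?thesis
  proof cases
    case 1
    then show ?thesis using pair not_2 y z by blast
  next
    case 2
    then have "br x (br z y) = 0" using pair not_2 y z by blast
    moreover have "br x (smul (-1) (br z y)) = smul (-1) (br x (br z y))"
      using xN yN zN by (simp only: br_simps)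
    ultimately show ?thesis using br_anti[OF yN zN] by simp
  next
    case 3
    then show ?thesis using br_zero[OF y(1) z(1) 3 y(2) z(2)] xN by (simp add: br_simps)
  qed
qed

text \<open>On \<open>L 2\<close> the Jacobi sum is an alternating equivariant trilinear map into
  \<open>L 6\<close>, since [L_2, [L_2, L_2]] lies in [L_2, L_5]. Its cyclic invariance reduces
  linearity in each argument to linearity in the first.\<close>

lemma jacobi_2_2_2:
  assumes "x \<in> L 2" "y \<in> L 2" "z \<in> L 2"
  shows "br x (br y z) + br y (br z x) + br z (br x y) = 0"
proof -
  let ?J = "\<lambda>x y z. br x (br y z) + br y (br z x) + br z (br x y)"
  have V: "sl2_irrep smul (L 2) (act sl2_e) (act sl2_h) (act sl2_f) 6 (hw_vector 2)"
    using irrep[OF small_indices(2)] by (simp add: highest_weight_small)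
  have W: "sl2_irrep smul (L 6) (act sl2_e) (act sl2_h) (act sl2_f) 2 (hw_vector 6)"
    using irrep[OF small_indices(6)] by (simp add: highest_weight_small)
  interpret V: sl2_irrep smul "L 2" "act sl2_e" "act sl2_h" "act sl2_f" 6 "hw_vector 2" by (rule V)
  interpret W: sl2_irrep smul "L 6" "act sl2_e" "act sl2_h" "act sl2_f" 2 "hw_vector 6" by (rule W)
  have mem: "br x (br y z) \<in> L 6" if "x \<in> L 2" "y \<in> L 2" "z \<in> L 2" for x y z
    using product_mem[OF prod_2_5 that(1) product_mem[OF prod_2_2 that(2,3)]] .
  have lin1: "linear_map_on smul (L 2) smul (L 6) (\<lambda>x. ?J x y z)" if "y \<in> L 2" "z \<in> L 2" for y z
    using that unfolding linear_map_on_def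
    by (simp add: mem W.V_closed br_simps small_in_N N_closed algebra_simps)
  have cycle: "?J x y z = ?J y z x" for x y z by (simp add: algebra_simps)
  have lin2: "linear_map_on smul (L 2) smul (L 6) (\<lambda>y. ?J x y z)" if "x \<in> L 2" "z \<in> L 2" for x z
  proof -
    have "(\<lambda>y. ?J x y z) = (\<lambda>y. ?J y z x)" by (intro ext cycle)
    then show ?thesis using lin1[OF that(2,1)] by simp
  qed
  have lin3: "linear_map_on smul (L 2) smul (L 6) (\<lambda>z. ?J x y z)" if "x \<in> L 2" "y \<in> L 2" for x y
  proof -
    have "(\<lambda>z. ?J x y z) = (\<lambda>z. ?J z x y)" by (intro ext cycle[symmetric])
    then show ?thesis using lin1[OF that] by simp
  qed
  have neg: "br x (- y) = - br x y" if "x \<in> N" "y \<in> N" for x y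
    using linear_map_onD(3)[OF br_linear(1)[OF that(1)] that(2), of "-1"] by simp
  show ?thesis
  proof (rule alternating_trilinear_V6_to_V2_zero[OF V W lin1 lin2 lin3 _ _ cycle assms])
    fix T x y z assume T: "T \<in> {act sl2_e, act sl2_h, act sl2_f}" and xyz: "x \<in> L 2" "y \<in> L 2" "z \<in> L 2"
    then obtain A where A: "A \<in> sl2" "T = act A" using sl2_basis_in_sl2 by blast
    show "T (?J x y z) = ?J (T x) y z + ?J x (T y) z + ?J x y (T z)"
      using A(1) xyz unfolding A(2)
      by (simp add: act_simps br_simps act_br small_in_N N_closed algebra_simps)
  next
    fix x y z assume xyz: "x \<in> L 2" "y \<in> L 2" "z \<in> L 2"
    then have N: "x \<in> N" "y \<in> N" "z \<in> N" by (auto intro: small_in_N)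
    have flip: "br x (br z y) = - br x (br y z)" if "x \<in> N" "y \<in> N" "z \<in> N" for x y z
      unfolding br_anti[OF that(3,2)] by (intro neg br_simps that)
    show "?J x y z = - ?J y x z"
      unfolding flip[OF N(1,2,3)] flip[OF N(2,3,1)] flip[OF N(3,1,2)] by simp
  qed
qed

text \<open>The arguments are extended from components to \<open>N\<close> one at a time; rotating
  the cyclic sum brings each of them into the first slot, where linearity is established.\<close>

lemma lie_algebra_N: "lie_algebra smul N br"
proof -
  have lin: "linear_map_on smul N smul N (\<lambda>x. br x (br y z) + br y (br z x) + br z (br x y))"
    if "y \<in> N" "z \<in> N" for y z
    using that unfolding linear_map_on_def by (simp add: br_simps N_closed algebra_simps)
  have cycle: "br x (br y z) + br y (br z x) + br z (br x y)
      = br y (br z x) + br z (br x y) + br x (br y z)" for x y z by (simp add: algebra_simps)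
  have 1: "br x (br y z) + br y (br z x) + br z (br x y) = 0"
    if "i \<in> {1..n}" "x \<in> L i" "j \<in> {1..n}" "y \<in> L j" "k \<in> {1..n}" "z \<in> L k" for i j k x y z
  proof (cases "i = 2 \<and> j = 2 \<and> k = 2")
    case True
    then show ?thesis using jacobi_2_2_2 that by simp
  next
    case False
    then show ?thesis
      using br_br_zero[of i x j y k z] br_br_zero[of j y k z i x] br_br_zero[of k z i x j y] that by auto
  qed
  have 2: "br x (br y z) + br y (br z x) + br z (br x y) = 0"
    if "x \<in> N" "j \<in> {1..n}" "y \<in> L j" "k \<in> {1..n}" "z \<in> L k" for j k x y z
  proof (rule linear_zero_on_N[OF lin _ that(1)])
    show "br x (br y z) + br y (br z x) + br z (br x y) = 0" if "i \<in> {1..n}" "x \<in> L i" for i x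
      by (rule 1[OF that]) fact+
  qed (use that in_N in blast)+
  have 3: "br x (br y z) + br y (br z x) + br z (br x y) = 0"
    if "x \<in> N" "y \<in> N" "k \<in> {1..n}" "z \<in> L k" for k x y z
  proof -
    have "br y (br z x) + br z (br x y) + br x (br y z) = 0"
    proof (rule linear_zero_on_N[OF lin _ that(2)])
      show "br y (br z x) + br z (br x y) + br x (br y z) = 0" if "j \<in> {1..n}" "y \<in> L j" for j y
        using 2[OF \<open>x \<in> N\<close> that \<open>k \<in> {1..n}\<close> \<open>z \<in> L k\<close>] unfolding cycle[of x y z] .
    qed (use that in_N in auto)
    then show ?thesis unfolding cycle[of x y z] .
  qed
  have 4: "br x (br y z) + br y (br z x) + br z (br x y) = 0" if "x \<in> N" "y \<in> N" "z \<in> N" for x y z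
  proof -
    have "br z (br x y) + br x (br y z) + br y (br z x) = 0"
    proof (rule linear_zero_on_N[OF lin _ that(3)])
      show "br z (br x y) + br x (br y z) + br y (br z x) = 0" if "k \<in> {1..n}" "z \<in> L k" for k z
        using 3[OF \<open>x \<in> N\<close> \<open>y \<in> N\<close> that] unfolding cycle[of z x y, symmetric] .
    qed (use that in auto)
    then show ?thesis unfolding cycle[of z x y] .
  qed
  show ?thesis
    by unfold_locales (rule N.M.subspace_carrier N.M.finite_dimensional br_bilinear br_alternating 4; assumption)+
qed

lemma lie_algebra_semidirect:
  "lie_algebra (prod_scale mat_scale smul) (sl2 \<times> N) (semidirect_bracket commutator act br)"
proof (rule semidirect_lie_algebra)
  show "sl2_module smul N act" by (rule N_module)
  show "lie_algebra smul N br" by (rule lie_algebra_N)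
qed (rule act_br)

section \<open>Derivations and the center\<close>

lemma proj_act:
  assumes "x \<in> sl2" "u \<in> N" "i \<in> {1..n}"
  shows "proj i (act x u) = act x (proj i u)"
  by (rule proj_commute[OF act_linear(1)[OF assms(1)] _ assms(2,3)]) (rule act_in_L[OF assms(1)])

lemma act_ext:
  assumes T: "linear_map_on mat_scale sl2 smul N T" and u: "u \<in> N"
    and "T sl2_e = act sl2_e u" "T sl2_h = act sl2_h u" "T sl2_f = act sl2_f u" and x: "x \<in> sl2"
  shows "T x = act x u"
  by (rule linear_map_on_sl2_ext[OF T act_linear(2)[OF u] assms(3-5) x])

lemma act_L1:
  assumes "x \<in> sl2" "u \<in> L 1"
  shows "act x u = 0"
proof -
  interpret V: sl2_irrep smul "L 1" "act sl2_e" "act sl2_h" "act sl2_f" "highest_weight r 1" "hw_vector 1"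
    by (rule irrep[OF small_indices(1)])
  have z: "linear_map_on mat_scale sl2 smul N (\<lambda>x. 0)"
    by (simp add: linear_map_on_def N_closed)
  have "(\<lambda>x. 0) x = act x u"
    by (rule act_ext[OF z small_in_N(1)[OF assms(2)] _ _ _ assms(1)])
      (use V.trivial_if_weight_zero[OF _ assms(2)] highest_weight_small in simp_all)
  then show ?thesis by simp
qed

text \<open>The action on \<open>L 1\<close> is trivial, so every vector there is a highest weight
  vector of weight 0; hence \<open>L 1\<close> is a line.\<close>

lemma L1_multiple:
  assumes "u \<in> L 1" "u \<noteq> 0" "w \<in> L 1"
  shows "\<exists>c. w = smul c u"
proof -
  interpret V: sl2_irrep smul "L 1" "act sl2_e" "act sl2_h" "act sl2_f" "highest_weight r 1" "hw_vector 1"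
    by (rule irrep[OF small_indices(1)])
  show ?thesis
    using assms act_L1[OF sl2_basis_in_sl2(1)] act_L1[OF sl2_basis_in_sl2(2)]
    by (intro V.highest_weight_multiple[of u 0]) simp_all
qed

lemma L_nonzero: "i \<in> {1..n} \<Longrightarrow> L i \<noteq> {0}"
  using sl2_irrep.v0(1,2)[OF irrep] by blast

lemma br_L1_nonzero:
  assumes "u \<in> L 1" "u \<noteq> 0"
  shows "\<exists>x\<in>L 2. br u x \<noteq> 0"
proof -
  obtain w x where w: "w \<in> L 1" "x \<in> L 2" "br w x \<noteq> 0"
    using product_nonzero[OF prod_1_2 L_nonzero[OF small_indices(3)]] by blast
  moreover obtain c where "w = smul c u" using L1_multiple[OF assms w(1)] by blast
  ultimately show ?thesis using assms by (auto simp: br_simps small_in_N)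
qed

text \<open>A component of an invariant vector is killed by \<open>e\<close> and has weight 0, which
  forces it to vanish wherever the highest weight is not 0.\<close>

lemma centralizer_of_sl2:
  assumes "u \<in> N" "\<And>x. x \<in> sl2 \<Longrightarrow> act x u = 0"
  shows "u \<in> L 1"
proof -
  have "proj i u = 0" if i: "i \<in> {1..n}" "i \<noteq> 1" for i
  proof -
    interpret V: sl2_irrep smul "L i" "act sl2_e" "act sl2_h" "act sl2_f" "highest_weight r i" "hw_vector i"
      by (rule irrep[OF i(1)])
    have zero: "act x (proj i u) = 0" if "x \<in> sl2" for x
      using proj_act[OF that assms(1) i(1)] assms(2)[OF that]
        linear_map_on_zero[OF linear_proj[OF i(1)] N_closed(1)] by simp
    have "highest_weight r i \<noteq> 0"
      using highest_weight_eq[OF i(1) small_indices(1)] i(2) highest_weight_small(1) by auto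
    then show ?thesis
      using V.highest_weight_zero[of "proj i u" 0]
      by (simp add: zero sl2_basis_in_sl2 proj(1)[OF assms(1) i(1)])
  qed
  then have "(\<Sum>i\<in>{1..n}. proj i u) = (\<Sum>i\<in>{1..n}. if i = 1 then proj 1 u else 0)"
    by (intro sum.cong[OF refl]) simp
  then have "u = proj 1 u" unfolding proj(2)[OF assms(1)] sum_single[OF small_indices(1)] .
  then show ?thesis using proj(1)[OF assms(1) small_indices(1)] by simp
qed

text \<open>Projections commute with the action, so the cocycle splits into cocycles with values in
  the irreducible components, and the vectors found there are added up.\<close>

lemma cocycle_N:
  assumes c: "linear_map_on mat_scale sl2 smul N c"
    and cocycle: "\<And>x y. x \<in> sl2 \<Longrightarrow> y \<in> sl2 \<Longrightarrow> c (commutator x y) = act x (c y) - act y (c x)"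
  shows "\<exists>u\<in>N. \<forall>x\<in>sl2. c x = act x u"
proof -
  note basis = sl2_basis_in_sl2
  note cN = linear_map_onD(1)[OF c]
  have eF: "act sl2_e (c sl2_f) = c sl2_h + act sl2_f (c sl2_e)"
    using cocycle[OF basis(1,3)] unfolding sl2_brackets by simp
  have hE: "act sl2_h (c sl2_e) = act sl2_e (c sl2_h) + smul 2 (c sl2_e)"
    using cocycle[OF basis(2,1)] unfolding sl2_brackets linear_map_onD(3)[OF c basis(1)]
    by (simp add: algebra_simps)
  have hF: "act sl2_h (c sl2_f) = act sl2_f (c sl2_h) - smul 2 (c sl2_f)"
    using cocycle[OF basis(2,3)] unfolding sl2_brackets linear_map_onD(3)[OF c basis(3)]
    by (simp add: algebra_simps)
  have "\<forall>i\<in>{1..n}. \<exists>a\<in>L i. act sl2_e a = proj i (c sl2_e) \<and> act sl2_h a = proj i (c sl2_h)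
      \<and> act sl2_f a = proj i (c sl2_f)"
  proof
    fix i assume i: "i \<in> {1..n}"
    interpret V: sl2_irrep smul "L i" "act sl2_e" "act sl2_h" "act sl2_f" "highest_weight r i" "hw_vector i"
      by (rule irrep[OF i])
    note lin = linear_map_onD[OF linear_proj[OF i]]
      linear_map_on_diff[OF linear_proj[OF i] module_axioms subspace_N]
    note p = proj_act[OF _ _ i, symmetric]
    show "\<exists>a\<in>L i. act sl2_e a = proj i (c sl2_e) \<and> act sl2_h a = proj i (c sl2_h)
        \<and> act sl2_f a = proj i (c sl2_f)"
      by (rule V.cocycle_is_coboundary)
        (simp_all add: p eF hE hF lin basis cN act_simps N_closed)
  qed
  then obtain a where a: "\<forall>i\<in>{1..n}. a i \<in> L i \<and> act sl2_e (a i) = proj i (c sl2_e)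
      \<and> act sl2_h (a i) = proj i (c sl2_h) \<and> act sl2_f (a i) = proj i (c sl2_f)"
    by metis
  let ?u = "\<Sum>i\<in>{1..n}. a i"
  have u: "?u \<in> N" using a by (intro sum_in_N) blast
  have act_u: "act x ?u = (\<Sum>i\<in>{1..n}. act x (a i))" if "x \<in> sl2" for x
    using a by (intro linear_map_on_sum[OF act_linear(1)[OF that] module_axioms subspace_N])
      (blast intro: in_N)
  have basis_eq: "c b = act b ?u" if "b \<in> {sl2_e, sl2_h, sl2_f}" for b
  proof -
    have b: "b \<in> sl2" using that basis by auto
    have "act b ?u = (\<Sum>i\<in>{1..n}. proj i (c b))"
      unfolding act_u[OF b] by (rule sum.cong[OF refl]) (use a that in auto)
    then show ?thesis by (simp only: proj(2)[OF cN[OF b]])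
  qed
  have "c x = act x ?u" if "x \<in> sl2" for x
    by (rule act_ext[OF c u _ _ _ that]) (simp_all add: basis_eq)
  with u show ?thesis by blast
qed

section \<open>Equivariant derivations of the nilradical\<close>

lemma equivariant_derivation:
  assumes d: "linear_map_on smul N smul N d"
    and equiv: "\<And>x u. x \<in> sl2 \<Longrightarrow> u \<in> N \<Longrightarrow> d (act x u) = act x (d u)"
    and leibniz: "\<And>u v. u \<in> N \<Longrightarrow> v \<in> N \<Longrightarrow> d (br u v) = br (d u) v + br u (d v)"
  shows "\<exists>z\<in>L 1. \<forall>u\<in>N. d u = br z u"
proof -
  note d_simps = linear_map_onD[OF d]
  note I = small_indices
  have proj_d: "linear_map_on smul (L i) smul (L j) (\<lambda>x. proj j (d x))"
    if "i \<in> {1..n}" "j \<in> {1..n}" for i j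
    unfolding linear_map_on_def using that linear_map_onD[OF linear_proj[OF that(2)]] in_N[OF _ that(1)]
    by (simp add: d_simps)
  have proj_d_act: "proj j (d (act x u)) = act x (proj j (d u))"
    if "x \<in> sl2" "u \<in> L i" "i \<in> {1..n}" "j \<in> {1..n}" for i j x u
    using that in_N[OF that(2,3)] by (simp add: equiv proj_act d_simps)
  have off: "proj j (d x) = 0"
    if "i \<in> {1..n}" "j \<in> {1..n}" "highest_weight r i \<noteq> highest_weight r j" "x \<in> L i" for i j x
    by (rule schur_zero[OF irrep[OF that(1)] irrep[OF that(2)] that(3) proj_d[OF that(1,2)] _ _ _ that(4)])
      (rule proj_d_act; (rule sl2_basis_in_sl2 that | assumption))+
  have diag: "\<exists>c. \<forall>x\<in>L i. proj i (d x) = smul c x" if i: "i \<in> {1..n}" for i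
  proof (rule schur_multiple[OF irrep[OF i] irrep[OF i] proj_d[OF i i], where S = "\<lambda>x. x"])
    show "linear_map_on smul (L i) smul (L i) (\<lambda>x. x)" by (simp add: linear_map_on_def)
    show "\<exists>x\<in>L i. x \<noteq> 0" using sl2_irrep.v0(1,2)[OF irrep[OF i]] by blast
  qed (rule proj_d_act refl; (rule sl2_basis_in_sl2 i | assumption))+
  have sum_d: "d x = (\<Sum>j\<in>J. proj j (d x))"
    if "i \<in> {1..n}" "x \<in> L i" "J \<subseteq> {1..n}" "\<And>j. j \<in> {1..n} - J \<Longrightarrow> highest_weight r i \<noteq> highest_weight r j"
    for i J x
  proof -
    have "(\<Sum>j\<in>J. proj j (d x)) = (\<Sum>j\<in>{1..n}. proj j (d x))"
      using that off by (intro sum.mono_neutral_left) auto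
    then show ?thesis using proj(2)[OF d_simps(1)] in_N that by simp
  qed
  have scalar: "\<exists>c. \<forall>x\<in>L i. d x = smul c x" if i: "i \<in> {1..n}" "i \<notin> {2, 3, 5}" for i
  proof -
    have "d x = proj i (d x)" if "x \<in> L i" for x
    proof -
      have "highest_weight r i \<noteq> highest_weight r j" if "j \<in> {1..n} - {i}" for j
        using highest_weight_eq[of i j] i that by auto
      then show ?thesis using sum_d[OF i(1) that, of "{i}"] i(1) by simp
    qed
    then show ?thesis using diag[OF i(1)] by metis
  qed
  obtain a1 a4 a6 \<alpha> where a1: "\<forall>x\<in>L 1. d x = smul a1 x" and a4: "\<forall>x\<in>L 4. d x = smul a4 x"
    and a6: "\<forall>x\<in>L 6. d x = smul a6 x" and \<alpha>: "\<forall>x\<in>L 2. proj 2 (d x) = smul \<alpha> x"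
    using scalar[OF I(1)] scalar[OF I(4)] scalar[OF I(6)] diag[OF I(2)] by auto
  define \<phi>3 \<phi>5 where "\<phi>3 x = proj 3 (d x)" and "\<phi>5 x = proj 5 (d x)" for x
  have \<phi>3: "\<phi>3 x \<in> L 3" and \<phi>5: "\<phi>5 x \<in> L 5" if "x \<in> L 2" for x
    unfolding \<phi>3_def \<phi>5_def using linear_map_onD(1)[OF proj_d] that I by blast+
  have d2: "d x = smul \<alpha> x + (\<phi>3 x + \<phi>5 x)" if x: "x \<in> L 2" for x
  proof -
    have "highest_weight r 2 \<noteq> highest_weight r j" if "j \<in> {1..n} - {2, 3, 5}" for j
      using highest_weight_eq[of 2 j] I that by auto
    then have "d x = (\<Sum>j\<in>{2, 3, 5}. proj j (d x))"
      using sum_d[OF I(2) x, of "{2, 3, 5}"] I by simp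
    then show ?thesis using \<alpha> x by (simp add: \<phi>3_def \<phi>5_def)
  qed
  have L2_3: "br x y = 0" "br y x = 0" if "x \<in> L i" "i \<in> {1..n}" "y \<in> L 3" for x y i
    using br_central[of 3 x y] br_anti[of y x] in_N that I by auto
  have br_12: "br z (d x) = smul \<alpha> (br z x)" if z: "z \<in> L 1" and x: "x \<in> L 2" for z x
  proof -
    have "br z (\<phi>3 x) = 0" using L2_3(1)[OF z I(1) \<phi>3[OF x]] .
    moreover have "br z (\<phi>5 x) = 0"
      using br_zero[OF I(1,5) _ _ z \<phi>5[OF x]] by (auto simp: product_pairs_def)
    ultimately show ?thesis
      using z x \<phi>3[OF x] \<phi>5[OF x] by (simp add: d2 br_simps small_in_N N_closed)
  qed
  \<comment> \<open>Schur's lemma would still allow parts of \<open>d w\<close> in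
    \<open>L 2\<close> and \<open>L 5\<close>. Products with \<open>L 1\<close> do not see
    \<open>\<phi>3\<close> and \<open>\<phi>5\<close>, so the generation of \<open>L 3\<close> by
    [L_1, L_2] excludes them. The same role is played by [L_2, L_2] in \<open>d5\<close>.\<close>
  have d3: "d w = smul (a1 + \<alpha>) w" if "w \<in> L 3" for w
  proof (rule product_eigenvalue[OF prod_1_2 _ _ d _ that])
    fix z x assume "z \<in> L 1" "x \<in> L 2"
    then show "d (br z x) = smul (a1 + \<alpha>) (br z x)"
      using a1 by (simp add: leibniz small_in_N br_12 br_simps scale_left_distrib)
  qed (use L_subset_N I in blast)+
  have br_22: "d (br x y) = smul (\<alpha> + \<alpha>) (br x y) + (br (\<phi>5 x) y + br x (\<phi>5 y))"
    if x: "x \<in> L 2" and y: "y \<in> L 2" for x y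
  proof -
    show ?thesis
      using x y \<phi>3[OF x] \<phi>3[OF y] \<phi>5[OF x] \<phi>5[OF y] L2_3(2)[OF y I(2) \<phi>3[OF x]] L2_3(1)[OF x I(2) \<phi>3[OF y]]
      unfolding scale_left_distrib
      by (simp add: leibniz d2 br_simps small_in_N N_closed add_ac)
  qed
  have br_25: "br x w \<in> L 6" "br w x \<in> L 6" if "x \<in> L 2" "w \<in> L 5" for x w
  proof -
    show "br x w \<in> L 6" by (rule product_mem[OF prod_2_5 that])
    then have "smul (-1) (br x w) \<in> L 6" by (rule subspace_scale[OF subspace_L[OF I(6)]])
    then show "br w x \<in> L 6" using br_anti[of w x] small_in_N that by simp
  qed
  \<comment> \<open>The component in \<open>L 6\<close> of \<open>br_22\<close>; it makes \<open>br x (\<phi>5 y)\<close> symmetric in \<open>x\<close> and \<open>y\<close>.\<close>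
  have \<phi>5_br: "br (\<phi>5 x) y + br x (\<phi>5 y) = 0" if x: "x \<in> L 2" and y: "y \<in> L 2" for x y
  proof -
    let ?w = "br (\<phi>5 x) y + br x (\<phi>5 y)"
    have w: "?w \<in> L 6"
      by (intro subspace_add[OF subspace_L[OF I(6)]] br_25 x y \<phi>5)
    have xy: "br x y \<in> L 5" by (rule product_mem[OF prod_2_2 x y])
    note lin = linear_map_onD[OF linear_proj[OF I(6)]]
    have "proj 6 (d (br x y)) = 0"
      by (rule off[OF I(5,6) _ xy]) (simp add: highest_weight_small)
    moreover have "proj 6 (d (br x y)) = smul (\<alpha> + \<alpha>) (proj 6 (br x y)) + proj 6 ?w"
      unfolding br_22[OF x y] using xy w by (simp only: lin small_in_N N_closed)
    ultimately show ?thesis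
      using proj_component[OF I(5) xy I(6)] proj_component[OF I(6) w I(6)] by simp
  qed
  have d5: "d w = smul (\<alpha> + \<alpha>) w" if "w \<in> L 5" for w
    by (rule product_eigenvalue[OF prod_2_2 _ _ d _ that])
      (use L_subset_N I br_22 \<phi>5_br in auto)
  have W6: "sl2_irrep smul (L 6) (act sl2_e) (act sl2_h) (act sl2_f) 2 (hw_vector 6)"
    using irrep[OF I(6)] by (simp add: highest_weight_small)
  have V2: "sl2_irrep smul (L 2) (act sl2_e) (act sl2_h) (act sl2_f) 6 (hw_vector 2)"
    using irrep[OF I(2)] by (simp add: highest_weight_small)
  have \<phi>5_lin: "linear_map_on smul (L 2) smul (L 5) \<phi>5"
    unfolding \<phi>5_def by (rule proj_d[OF I(2,5)])
  have \<phi>5_act: "\<phi>5 (act x u) = act x (\<phi>5 u)" if "x \<in> sl2" "u \<in> L 2" for x u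
    unfolding \<phi>5_def by (rule proj_d_act[OF that I(2,5)])
  have br_\<phi>5: "br x (\<phi>5 y) = 0" if "x \<in> L 2" "y \<in> L 2" for x y
  proof (rule symmetric_bilinear_V6_to_V2_zero[OF V2 W6, of "\<lambda>x y. br x (\<phi>5 y)", OF _ _ _ that])
    show "bilinear_map_on smul (L 2) smul (L 2) smul (L 6) (\<lambda>x y. br x (\<phi>5 y))"
      unfolding bilinear_map_on_def linear_map_on_def
      by (simp add: br_25 \<phi>5 linear_map_onD[OF \<phi>5_lin] br_simps small_in_N)
  next
    fix T x y assume "T \<in> {act sl2_e, act sl2_h, act sl2_f}" and xy: "x \<in> L 2" "y \<in> L 2"
    then obtain A where A: "A \<in> sl2" "T = act A" using sl2_basis_in_sl2 by blast
    show "T (br x (\<phi>5 y)) = br (T x) (\<phi>5 y) + br x (\<phi>5 (T y))"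
      unfolding A(2) \<phi>5_act[OF A(1) xy(2)] by (rule act_br[OF A(1)]) (use xy \<phi>5 small_in_N in blast)+
  next
    fix x y assume xy: "x \<in> L 2" "y \<in> L 2"
    have "br x (\<phi>5 y) = - br (\<phi>5 x) y"
      using \<phi>5_br[OF xy] by (simp only: eq_neg_iff_add_eq_0 add.commute)
    also have "\<dots> = br y (\<phi>5 x)"
      by (rule br_anti[symmetric]) (use xy \<phi>5 small_in_N in blast)+
    finally show "br x (\<phi>5 y) = br y (\<phi>5 x)" .
  qed
  have \<phi>5_zero: "\<phi>5 y = 0" if y: "y \<in> L 2" for y
  proof (rule ccontr)
    assume nz: "\<phi>5 y \<noteq> 0"
    interpret V5: sl2_irrep smul "L 5" "act sl2_e" "act sl2_h" "act sl2_f" "highest_weight r 5" "hw_vector 5"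
      by (rule irrep[OF I(5)])
    \<comment> \<open>The annihilator of \<open>L 2\<close> in \<open>L 5\<close> is a submodule. A
      nonzero value of \<open>\<phi>5\<close> would make it all of \<open>L 5\<close>, against
      [L_2, L_5] = L_6.\<close>
    let ?W = "{w \<in> L 5. \<forall>x\<in>L 2. br x w = 0}"
    have act_W: "act A w \<in> ?W" if "A \<in> sl2" "w \<in> ?W" for A w
    proof -
      have "br x (act A w) = 0" if x: "x \<in> L 2" for x
        using act_br[OF \<open>A \<in> sl2\<close>, of x w] \<open>w \<in> ?W\<close> x act_in_L[OF \<open>A \<in> sl2\<close> I(2) x] \<open>A \<in> sl2\<close>
        by (simp add: small_in_N act_simps)
      then show ?thesis using that act_in_L[OF _ I(5)] by simp
    qed
    have "?W = L 5"
    proof (rule V5.full_if_contains)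
      show "subspace ?W" unfolding subspace_def
        by (simp add: V5.V_closed br_simps small_in_N)
      show "\<phi>5 y \<in> ?W" using br_\<phi>5 y \<phi>5 by simp
      show "act sl2_e w \<in> ?W \<and> act sl2_h w \<in> ?W \<and> act sl2_f w \<in> ?W" if "w \<in> ?W" for w
        by (intro conjI act_W sl2_basis_in_sl2 that)
    qed (use nz in auto)
    then show False
      using product_nonzero[OF prod_2_5 L_nonzero[OF I(6)]] by blast
  qed
  have d2': "d x = smul \<alpha> x + \<phi>3 x" if "x \<in> L 2" for x
    using d2[OF that] \<phi>5_zero[OF that] by simp
  have eigen_unique: "a = b" if "i \<in> {1..n}" "\<And>x. x \<in> L i \<Longrightarrow> d x = smul a x" "\<And>x. x \<in> L i \<Longrightarrow> d x = smul b x" for a b i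
  proof -
    note v = sl2_irrep.v0(1,2)[OF irrep[OF that(1)]]
    then have "smul a (hw_vector i) = smul b (hw_vector i)" using that(2,3) by metis
    then show ?thesis using v(2) scale_right_imp_eq by blast
  qed
  have "d w = smul (\<alpha> + a4) w" if "w \<in> L 6" for w
  proof (rule product_eigenvalue[OF prod_2_4 _ _ d _ that])
    fix x y assume x: "x \<in> L 2" and y: "y \<in> L 4"
    then show "d (br x y) = smul (\<alpha> + a4) (br x y)"
      using a4 \<phi>3[OF x] L2_3(2)[OF y I(4) \<phi>3[OF x]]
      by (simp add: leibniz d2' br_simps small_in_N N_closed scale_left_distrib)
  qed (use L_subset_N I in blast)+
  then have 1: "a6 = \<alpha> + a4" using eigen_unique[OF I(6)] a6 by blast
  have "d w = smul (\<alpha> + (\<alpha> + \<alpha>)) w" if "w \<in> L 6" for w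
  proof (rule product_eigenvalue[OF prod_2_5 _ _ d _ that])
    fix x y assume x: "x \<in> L 2" and y: "y \<in> L 5"
    show "d (br x y) = smul (\<alpha> + (\<alpha> + \<alpha>)) (br x y)"
      using \<phi>3[OF x] L2_3(2)[OF y I(5) \<phi>3[OF x]] x y unfolding scale_left_distrib
      by (simp add: leibniz d2' d5[unfolded scale_left_distrib] br_simps small_in_N N_closed)
  qed (use L_subset_N I in blast)+
  then have 2: "a6 = \<alpha> + (\<alpha> + \<alpha>)" using eigen_unique[OF I(6)] a6 by blast
  \<comment> \<open>The products of \<open>L 4\<close> span both summands, so one scalar governs
    \<open>L 6\<close> and \<open>L 3\<close> together; the second summand is what ties
    \<open>a1\<close> to the other eigenvalues.\<close>
  have 44: "d w = smul (a4 + a4) w" if "w \<in> {u + v | u v. u \<in> L 6 \<and> v \<in> L 3}" for w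
  proof (rule product_eigenvalue[OF prod_4_4 _ _ d _ that])
    fix x y assume "x \<in> L 4" "y \<in> L 4"
    then show "d (br x y) = smul (a4 + a4) (br x y)"
      using a4 unfolding scale_left_distrib by (simp add: leibniz br_simps small_in_N)
  qed (use L_subset_N I in blast)+
  have "d w = smul (a4 + a4) w" if "w \<in> L 6" for w
    using that subspace_0[OF subspace_L[OF I(3)]] by (intro 44 CollectI exI[of _ w] exI[of _ 0]) simp
  then have 3: "a6 = a4 + a4" using eigen_unique[OF I(6)] a6 by blast
  have "d w = smul (a4 + a4) w" if "w \<in> L 3" for w
    using that subspace_0[OF subspace_L[OF I(6)]] by (intro 44 CollectI exI[of _ 0] exI[of _ w]) simp
  then have 4: "a1 + \<alpha> = a4 + a4" using eigen_unique[OF I(3)] d3 by blast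
  have zero: "\<alpha> = 0" "a4 = 0" "a6 = 0" "a1 = 0"
  proof -
    \<comment> \<open>Then \<open>a6\<close> equals both \<open>3 * \<alpha>\<close> and
      \<open>4 * \<alpha>\<close>.\<close>
    have "a4 = 2 * \<alpha>" using 1 2 by simp
    then show "\<alpha> = 0" using 2 3 by simp
    then show "a4 = 0" "a6 = 0" "a1 = 0" using \<open>a4 = 2 * \<alpha>\<close> 2 4 by simp_all
  qed
  have d_zero: "d x = 0" if i: "i \<in> {1..n}" "i \<noteq> 2" and x: "x \<in> L i" for i x
  proof -
    consider "i = 1" | "i = 3" | "i = 4" | "i = 5" | "i = 6" | "i \<in> {7..n}"
      using i by (cases "i < 7") fastforce+
    then show ?thesis
    proof cases
      case 1 then show ?thesis using a1 x zero by simp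
    next
      case 2 then show ?thesis using d3 x zero by simp
    next
      case 3 then show ?thesis using a4 x zero by simp
    next
      case 4 then show ?thesis using d5 x zero by simp
    next
      case 5 then show ?thesis using a6 x zero by simp
    next
      case 6
      then have "i \<notin> {2, 3, 5}" by auto
      then obtain c where c: "\<forall>x\<in>L i. d x = smul c x" using scalar i(1) by blast
      have "d w = smul (c + c) w" if "w \<in> L 6" for w
      proof (rule product_eigenvalue[OF prod_k_k[rule_format, OF 6] _ _ d _ that])
        fix x y assume "x \<in> L i" "y \<in> L i"
        then show "d (br x y) = smul (c + c) (br x y)"
          using c in_N[OF _ i(1)] unfolding scale_left_distrib by (simp add: leibniz br_simps)
      qed (use L_subset_N i(1) in blast)+
      then have "a6 = c + c" using eigen_unique[OF I(6)] a6 by blast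
      then have "c = 0" using zero by simp
      then show ?thesis using c x by simp
    qed
  qed
  define z where "z = hw_vector 1"
  have z: "z \<in> L 1" "z \<noteq> 0" unfolding z_def using sl2_irrep.v0(1,2)[OF irrep[OF I(1)]] by auto
  have br_z_act: "br z (act x u) = act x (br z u)" if "x \<in> sl2" "u \<in> N" for x u
    using act_br[OF that(1) small_in_N(1)[OF z(1)] that(2)] act_L1[OF that(1) z(1)] that(2)
    by (simp add: br_simps)
  \<comment> \<open>Since \<open>z\<close> is invariant under sl2, \<open>br z\<close> is an
    equivariant map from \<open>L 2\<close> to \<open>L 3\<close>; it is nonzero, so every other
    such map is a multiple of it.\<close>
  have "\<exists>c. \<forall>x\<in>L 2. \<phi>3 x = smul c (br z x)"
  proof (rule schur_multiple[OF irrep[OF I(2)] irrep[OF I(3)]])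
    show "linear_map_on smul (L 2) smul (L 3) \<phi>3"
      unfolding \<phi>3_def by (rule proj_d[OF I(2,3)])
    show "linear_map_on smul (L 2) smul (L 3) (br z)"
      using prod_1_2 z(1) by (simp add: sl2_product_def bilinear_map_on_def)
    show "\<exists>x\<in>L 2. br z x \<noteq> 0" by (rule br_L1_nonzero[OF z])
  qed (unfold \<phi>3_def, (rule proj_d_act[OF _ _ I(2,3)] br_z_act; (rule sl2_basis_in_sl2 small_in_N | assumption)+)+)
  then obtain c where c: "\<forall>x\<in>L 2. \<phi>3 x = smul c (br z x)" by blast
  have cz: "smul c z \<in> L 1" by (rule subspace_scale[OF subspace_L[OF I(1)] z(1)])
  have "d u = br (smul c z) u" if "u \<in> N" for u
  proof (rule linear_eq_on_N[OF d br_linear(1)[OF small_in_N(1)[OF cz]] _ that])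
    fix i x assume i: "i \<in> {1..n}" and x: "x \<in> L i"
    show "d x = br (smul c z) x"
    proof (cases "i = 2")
      case True
      then show ?thesis
        using x c d2' zero z small_in_N by (simp add: br_simps)
    next
      case False
      then have "br (smul c z) x = 0"
        using br_zero[OF I(1) i _ _ cz x] by (auto simp: product_pairs_def)
      then show ?thesis using d_zero[OF i False x] by simp
    qed
  qed
  then show ?thesis using cz by blast
qed

section \<open>Center and derivations of the semidirect product\<close>

abbreviation scale_L :: "complex \<Rightarrow> (complex^2^2) \<times> 'a \<Rightarrow> (complex^2^2) \<times> 'a" where
  "scale_L \<equiv> prod_scale mat_scale smul"

abbreviation bracket_L :: "(complex^2^2) \<times> 'a \<Rightarrow> (complex^2^2) \<times> 'a \<Rightarrow> (complex^2^2) \<times> 'a" where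
  "bracket_L \<equiv> semidirect_bracket commutator act br"

sublocale LA: lie_algebra scale_L "sl2 \<times> N" bracket_L
  by (rule lie_algebra_semidirect)

lemma commutator_zero: "commutator x 0 = 0" "commutator 0 x = 0"
  by (simp_all add: commutator_def matrix_matrix_mult_def vec_eq_iff)

lemma zero_in_sl2: "0 \<in> sl2"
  by (simp add: sl2_mem_iff)

lemma bracket_L_simps:
  assumes "x \<in> sl2" "y \<in> sl2" "u \<in> N" "v \<in> N"
  shows "bracket_L (x, 0) (y, 0) = (commutator x y, 0)"
    and "bracket_L (x, 0) (y, v) = (commutator x y, act x v)"
    and "bracket_L (x, u) (y, 0) = (commutator x y, - act y u)"
    and "bracket_L (0, u) (y, v) = (0, br u v - act y u)"
  using assms
  by (simp_all add: semidirect_bracket_def act_simps br_simps N_closed zero_in_sl2 commutator_zero)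

lemma center_L: "LA.center = {0}"
proof
  show "{0} \<subseteq> LA.center"
  proof
    fix p :: "(complex^2^2) \<times> 'a" assume "p \<in> {0}"
    then have p: "p = (0, 0)" by (simp add: zero_prod_def)
    show "p \<in> LA.center"
      unfolding LA.center_def p using bracket_L_simps(4)[OF zero_in_sl2 _ N_closed(1)]
      by (auto simp: zero_in_sl2 N_closed zero_prod_def act_simps br_simps)
  qed
  show "LA.center \<subseteq> {0}"
  proof
    fix p assume "p \<in> LA.center"
    then obtain a u where p: "p = (a, u)" and a: "a \<in> sl2" and u: "u \<in> N"
      and central: "\<And>q. q \<in> sl2 \<times> N \<Longrightarrow> bracket_L (a, u) q = 0"
      by (auto simp: LA.center_def)
    have comm: "commutator a x = 0" "act x u = 0" if "x \<in> sl2" for x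
      using central[of "(x, 0)"] bracket_L_simps(3)[OF a that u u] that
      by (simp_all add: N_closed zero_prod_def)
    have a0: "a = 0"
      using comm(1)[OF sl2_basis_in_sl2(1)] comm(1)[OF sl2_basis_in_sl2(2)] a
      by (simp add: sl2_matrix_simps)
    have u1: "u \<in> L 1" using centralizer_of_sl2[OF u comm(2)] .
    have "br u x = 0" if "x \<in> L 2" for x
      using central[of "(0, x)"] bracket_L_simps(4)[OF zero_in_sl2 zero_in_sl2 u small_in_N(2)[OF that]]
        small_in_N(2)[OF that] u zero_in_sl2 a0 by (simp add: zero_prod_def act_simps)
    then have "u = 0" using br_L1_nonzero[OF u1] by blast
    then show "p \<in> {0}" using p a0 by (simp add: zero_prod_def)
  qed
qed

text \<open>The restriction to sl2 has two components, a derivation of sl2 and a 1-cocycle with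
  values in \<open>N\<close>, and both are coboundaries. The sign of \<open>- u\<close> comes from
  the bracket of \<open>(a, u)\<close> with \<open>(x, 0)\<close>, whose second component is
  \<open>- act x u\<close>.\<close>

lemma derivation_inner_on_sl2:
  assumes "LA.derivation D"
  shows "\<exists>p\<in>sl2 \<times> N. \<forall>x\<in>sl2. D (x, 0) = bracket_L p (x, 0)"
proof -
  have lin: "linear_map_on scale_L (sl2 \<times> N) scale_L (sl2 \<times> N) D"
    and leibniz: "\<And>p q. p \<in> sl2 \<times> N \<Longrightarrow> q \<in> sl2 \<times> N
      \<Longrightarrow> D (bracket_L p q) = bracket_L (D p) q + bracket_L p (D q)"
    using assms by (auto simp: LA.derivation_def)
  define b c where "b x = fst (D (x, 0))" and "c x = snd (D (x, 0))" for x
  have D_eq: "D (x, 0) = (b x, c x)" for x by (simp add: b_def c_def)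
  have bc: "b x \<in> sl2" "c x \<in> N" if "x \<in> sl2" for x
    using linear_map_onD(1)[OF lin, of "(x, 0)"] that N_closed D_eq by auto
  have add: "D (x + y, 0) = D (x, 0) + D (y, 0)" if "x \<in> sl2" "y \<in> sl2" for x y
    using linear_map_onD(2)[OF lin, of "(x, 0)" "(y, 0)"] that N_closed by simp
  have scale: "D (mat_scale k x, 0) = scale_L k (D (x, 0))" if "x \<in> sl2" for k x
    using linear_map_onD(3)[OF lin, of "(x, 0)" k] that N_closed by (simp add: prod_scale_def)
  have b_lin: "linear_map_on mat_scale sl2 mat_scale sl2 b"
    and c_lin: "linear_map_on mat_scale sl2 smul N c"
    using add scale bc by (simp_all add: linear_map_on_def D_eq prod_scale_def)
  have comm: "b (commutator x y) = commutator (b x) y + commutator x (b y)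
      \<and> c (commutator x y) = act x (c y) - act y (c x)" if "x \<in> sl2" "y \<in> sl2" for x y
    using leibniz[of "(x, 0)" "(y, 0)"] that N_closed(1)
    by (simp add: D_eq bc bracket_L_simps[OF that N_closed(1) N_closed(1)]
        bracket_L_simps(2)[OF that(1) bc(1)[OF that(2)] N_closed(1) bc(2)[OF that(2)]]
        bracket_L_simps(3)[OF bc(1)[OF that(1)] that(2) bc(2)[OF that(1)] N_closed(1)])
  obtain a where a: "a \<in> sl2" "\<forall>x\<in>sl2. b x = commutator a x"
    using derivation_sl2_inner[OF b_lin] comm by blast
  obtain u where u: "u \<in> N" "\<forall>x\<in>sl2. c x = act x u"
    using cocycle_N[OF c_lin] comm by blast
  have mu: "- u \<in> N" using subspace_neg[OF subspace_N u(1)] .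
  have "act x (- u) = - act x u" if "x \<in> sl2" for x
    using linear_map_onD(3)[OF act_linear(1)[OF that] u(1), of "-1"] by simp
  then have "D (x, 0) = bracket_L (a, - u) (x, 0)" if "x \<in> sl2" for x
    using bracket_L_simps(3)[OF a(1) that mu mu] that a u by (simp add: D_eq)
  then show ?thesis using a mu by blast
qed

text \<open>By the Leibniz rule against elements of sl2 both components of \<open>D\<close> on
  \<open>N\<close> are equivariant. As sl2 is \<open>V\<^sub>2\<close>, its component
  \<open>s\<close> can be nonzero only on \<open>L 6\<close>, and there it vanishes because
  \<open>L 6\<close> is spanned by products.\<close>

lemma derivation_inner_if_zero_on_sl2:
  assumes "LA.derivation D" and zero: "\<And>x. x \<in> sl2 \<Longrightarrow> D (x, 0) = 0"
  shows "\<exists>p\<in>sl2 \<times> N. \<forall>q\<in>sl2 \<times> N. D q = bracket_L p q"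
proof -
  have lin: "linear_map_on scale_L (sl2 \<times> N) scale_L (sl2 \<times> N) D"
    and leibniz: "\<And>p q. p \<in> sl2 \<times> N \<Longrightarrow> q \<in> sl2 \<times> N
      \<Longrightarrow> D (bracket_L p q) = bracket_L (D p) q + bracket_L p (D q)"
    using assms by (auto simp: LA.derivation_def)
  define s d where "s u = fst (D (0, u))" and "d u = snd (D (0, u))" for u
  have D_eq: "D (0, u) = (s u, d u)" for u by (simp add: s_def d_def)
  have sd: "s u \<in> sl2" "d u \<in> N" if "u \<in> N" for u
    using linear_map_onD(1)[OF lin, of "(0, u)"] that zero_in_sl2 D_eq by auto
  have add: "D (0, u + v) = D (0, u) + D (0, v)" if "u \<in> N" "v \<in> N" for u v
    using linear_map_onD(2)[OF lin, of "(0, u)" "(0, v)"] that zero_in_sl2 by simp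
  have scale: "D (0, smul k u) = scale_L k (D (0, u))" if "u \<in> N" for k u
    using linear_map_onD(3)[OF lin, of "(0, u)" k] that zero_in_sl2 by (simp add: prod_scale_def)
  have s_lin: "linear_map_on smul N mat_scale sl2 s" and d_lin: "linear_map_on smul N smul N d"
    using add scale sd by (simp_all add: linear_map_on_def D_eq prod_scale_def)
  have equiv: "s (act x u) = commutator x (s u)" "d (act x u) = act x (d u)"
    if x: "x \<in> sl2" and u: "u \<in> N" for x u
  proof -
    have "D (0, act x u) = bracket_L (D (x, 0)) (0, u) + bracket_L (x, 0) (D (0, u))"
      using leibniz[of "(x, 0)" "(0, u)"] bracket_L_simps(2)[OF x zero_in_sl2 u u] x u
      by (simp add: N_closed zero_in_sl2 commutator_zero)
    also have "bracket_L (D (x, 0)) (0, u) = 0"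
      using bracket_L_simps(4)[OF zero_in_sl2 zero_in_sl2 N_closed(1) u] u
      by (simp add: zero x zero_prod_def act_simps br_simps zero_in_sl2 N_closed)
    finally have "(s (act x u), d (act x u)) = (commutator x (s u), act x (d u))"
      using bracket_L_simps(2)[OF x sd(1)[OF u] u sd(2)[OF u]] by (simp add: D_eq)
    then show "s (act x u) = commutator x (s u)" "d (act x u) = act x (d u)" by auto
  qed
  \<comment> \<open>A bracket with an element of the ideal \<open>N\<close> has no sl2 part, so
    \<open>s\<close> kills all products; \<open>d\<close> becomes a derivation of \<open>N\<close>
    only once \<open>s\<close> is known to vanish.\<close>
  have prod: "s (br u v) = 0" "d (br u v) = act (s u) v - act (s v) u + (br (d u) v + br u (d v))"
    if u: "u \<in> N" and v: "v \<in> N" for u v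
  proof -
    have "D (0, br u v) = bracket_L (s u, d u) (0, v) + bracket_L (0, u) (s v, d v)"
      using leibniz[of "(0, u)" "(0, v)"] bracket_L_simps(4)[OF zero_in_sl2 zero_in_sl2 u v] u v
      by (simp add: D_eq zero_in_sl2 act_simps)
    moreover have "bracket_L (s u, d u) (0, v) = (0, act (s u) v + br (d u) v)"
      using u v sd by (simp add: semidirect_bracket_def commutator_zero act_simps br_simps)
    moreover have "bracket_L (0, u) (s v, d v) = (0, br u (d v) - act (s v) u)"
      by (rule bracket_L_simps(4)[OF zero_in_sl2 sd(1)[OF v] u sd(2)[OF v]])
    ultimately show "s (br u v) = 0"
      "d (br u v) = act (s u) v - act (s v) u + (br (d u) v + br u (d v))"
      by (simp_all add: D_eq)
  qed
  have s_zero: "s u = 0" if "u \<in> N" for u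
  proof (rule linear_zero_on_N[OF s_lin _ that])
    fix i x assume i: "i \<in> {1..n}" and x: "x \<in> L i"
    show "s x = 0"
    proof (cases "i = 6")
      case True
      show ?thesis
      proof (rule linear_zero_on_span[OF s_lin _ subspace_N])
        show "module mat_scale" by (rule N.module_axioms)
        show "x \<in> span {br u v | u v. u \<in> L 2 \<and> v \<in> L 4}"
          using prod_2_4 x True by (simp add: sl2_product_def)
        show "{br u v | u v. u \<in> L 2 \<and> v \<in> L 4} \<subseteq> N"
          using br_linear(1)[THEN linear_map_onD(1)] small_in_N by auto
      qed (use prod(1) small_in_N in auto)
    next
      case False
      have "highest_weight r i \<noteq> 2"
        using highest_weight_eq[OF i small_indices(6)] False highest_weight_small(7) by auto
      then show ?thesis
      proof (rule schur_zero[OF irrep[OF i] adjoint_sl2_irrep])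
        show "linear_map_on smul (L i) mat_scale sl2 s"
          by (rule linear_map_on_component[OF s_lin i])
      qed (use equiv(1) sl2_basis_in_sl2 in_N[OF _ i] x in blast)+
    qed
  qed
  have "\<exists>z\<in>L 1. \<forall>u\<in>N. d u = br z u"
  proof (rule equivariant_derivation[OF d_lin equiv(2)])
    fix u v assume "u \<in> N" "v \<in> N"
    then show "d (br u v) = br (d u) v + br u (d v)"
      using prod(2) by (simp add: s_zero act_simps)
  qed
  then obtain z where z: "z \<in> L 1" "\<forall>u\<in>N. d u = br z u" by blast
  note zN = small_in_N(1)[OF z(1)]
  have "D q = bracket_L (0, z) q" if q_in: "q \<in> sl2 \<times> N" for q
  proof -
    obtain x u where q: "q = (x, u)" "x \<in> sl2" "u \<in> N" using q_in by auto
    have "D q = D (x, 0) + D (0, u)"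
      using linear_map_onD(2)[OF lin, of "(x, 0)" "(0, u)"] q zero_in_sl2 N_closed(1) by simp
    then show ?thesis
      using bracket_L_simps(4)[OF zero_in_sl2 q(2) zN q(3)] act_L1[OF q(2) z(1)] z(2) q
      by (simp add: D_eq s_zero zero)
  qed
  then show ?thesis using zN zero_in_sl2 by (intro bexI[of _ "(0, z)"]) auto
qed

lemma derivation_inner:
  assumes "LA.derivation D"
  shows "LA.inner_derivation D"
proof -
  obtain p where p: "p \<in> sl2 \<times> N" "\<forall>x\<in>sl2. D (x, 0) = bracket_L p (x, 0)"
    using derivation_inner_on_sl2[OF assms] by blast
  obtain q where q: "q \<in> sl2 \<times> N" "\<forall>t\<in>sl2 \<times> N. D t - bracket_L p t = bracket_L q t"
    using derivation_inner_if_zero_on_sl2[OF LA.derivation_minus_inner[OF assms p(1)]] p by auto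
  have "D t = bracket_L (p + q) t" if "t \<in> sl2 \<times> N" for t
    using linear_map_onD(2)[OF LA.bracket_linear(2)[OF that] p(1) q(1)] q(2) that
    by (metis add.commute diff_eq_eq)
  then show ?thesis
    unfolding LA.inner_derivation_def
    by (intro bexI[of _ "p + q"] ballI LA.subspace_add[OF LA.subspace_carrier] p q)
qed

lemma complete: "complete_lie_algebra scale_L (sl2 \<times> N) bracket_L"
  by unfold_locales (rule center_L, rule derivation_inner)

end

theorem theorem4p5:
  fixes n :: nat and r :: "nat \<Rightarrow> nat"
    and smul :: "complex \<Rightarrow> 'a::ab_group_add \<Rightarrow> 'a"
    and N :: "'a set" and L :: "nat \<Rightarrow> 'a set"
    and act :: "complex^2^2 \<Rightarrow> 'a \<Rightarrow> 'a"
    and br :: "'a \<Rightarrow> 'a \<Rightarrow> 'a"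
  assumes n: "n \<ge> 6"
    and r_ge: "\<forall>j\<in>{7..n}. r j \<ge> 4"
    and r_distinct: "inj_on r {7..n}"
    and N_module: "sl2_module smul N act"
    and N_sum: "internal_direct_sum smul {1..n} L N"
    and L_irreducible:
      "\<forall>i\<in>{1..n}. irreducible_sl2_module smul (L i) act (highest_weight r i)"
    and br_bilinear: "bilinear_map_on smul N smul N smul N br"
    and br_alternating: "alternating_on N br"
    and prod_1_2: "sl2_product smul act br (L 1) (L 2) (L 3)"
    and prod_2_2: "sl2_product smul act br (L 2) (L 2) (L 5)"
    and prod_2_4: "sl2_product smul act br (L 2) (L 4) (L 6)"
    and prod_2_5: "sl2_product smul act br (L 2) (L 5) (L 6)"
    and prod_4_4: "sl2_product smul act br (L 4) (L 4) {u + v | u v. u \<in> L 6 \<and> v \<in> L 3}"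
    and prod_k_k: "\<forall>k\<in>{7..n}. sl2_product smul act br (L k) (L k) (L 6)"
    and prod_other:
      "\<forall>i\<in>{1..n}. \<forall>j\<in>{i..n}.
         (i, j) \<notin> {(1, 2), (2, 2), (2, 4), (2, 5), (4, 4)} \<union> {(k, k) | k. k \<in> {7..n}} \<longrightarrow>
         (\<forall>x\<in>L i. \<forall>y\<in>L j. br x y = 0)"
  shows "complete_lie_algebra (prod_scale mat_scale smul) (sl2 \<times> N)
           (semidirect_bracket commutator act br)"
proof -
  interpret sl2_nilradical n r smul N L act br
    by (rule sl2_nilradical.intro) (fact assms)+
  show ?thesis by (rule complete)
qed

end
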